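(* Suppose $\mathcal G$ is a finite, implicitly represented workflow-type class whose rational data have encoding length at most $B$, and $c_g\le c_{\max}$ for every $g\in\mathcal G$. Suppose the selector follows the Plackett–Luce recovery curve with strength $\lambda\ge1$, and let the cardinality grid $\mathcal K\subseteq\{1,\dots,K_{\max}\}$ have coverage ratio $\varrho\ge1$ (for every $k\le K_{\max}$ there is $b\in\mathcal K$ with $b\le k\le\varrho b$). Retain a feasible baseline portfolio $\boldsymbol m^0$ with $\Pi_{\lambda,\gamma}(\boldsymbol m^0)\ge\underline V>0$. Suppose every primitive pricing call, made at prices $\mu$ with tolerance $\delta$, returns a workflow $\widetilde g\in\mathcal G$ satisfying $s_{\widetilde g}(\mu)\ge\max_{g\in\mathcal G}s_g(\mu)-\delta$ with probability at least $p_{\mathrm{orc}}>0$ conditional on the query history. Run the Ellipsoid-Based Dual-Guided Workflow Optimization algorithm (described in the context) with batch size $m$ and tolerance $\varepsilon_{\mathrm{ell}}>0$, let $N_{\mathrm{ell}}=N_{\mathrm{ell}}(\varepsilon_{\mathrm{ell}})$, and let $T=mN_{\mathrm{ell}}$. Then, with probability at least $$1-N_{\mathrm{ell}}e^{-p_{\mathrm{orc}}m}=1-\exp\Big\{-\frac{p_{\mathrm{orc}}T}{N_{\mathrm{ell}}}+\log N_{\mathrm{ell}}\Big\},$$ all batched separation calls satisfy their weak-pricing guarantees, and the returned portfolio $\widehat{\boldsymbol M}$ obeys $$\mathbb E_{\mathrm{rnd}}\big[\Pi_{\lambda,\gamma}(\widehat{\boldsymbol M})\big]\ge\max\Big\{\underline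 V,\ \frac1\varrho\mathrm{OPT}_{\lambda,\gamma}(\mathcal G)-\varepsilon_{\mathrm{ell}}-\varepsilon_{\mathrm{rnd}}(\mathcal K,\lambda)\Big\}.$$ Consequently, $$\mathbb E_{\mathrm{rnd}}\big[\Pi_{\lambda,\gamma}(\widehat{\boldsymbol M})\big]\ge\frac1\varrho\,\frac{\underline V}{\underline V+\varepsilon_{\mathrm{ell}}+\varepsilon_{\mathrm{rnd}}(\mathcal K,\lambda)}\,\mathrm{OPT}_{\lambda,\gamma}(\mathcal G).$$ Here $\mathbb E_{\mathrm{rnd}}$ is the expectation over the final randomized-rounding step, conditional on the successful batched-separation event.
   Context: Setting. There are $n\ge1$ tasks $i=1,\dots,n$, workflow types $g\in\mathcal G$ (finite, nonempty), correctness indicators $a_{ig}\in\{0,1\}$, costs $c_g\ge0$, cost price $\gamma\ge0$, integer $K_{\max}\ge1$. For $\boldsymbol m\in\mathbb Z_+^{\mathcal G}$: $k(\boldsymbol m)=\sum_gm_g$ (feasible: $k(\boldsymbol m)\le K_{\max}$), $r_i(\boldsymbol m)=\sum_ga_{ig}m_g$, $C(\boldsymbol m)=\sum_gc_gm_g$. Plackett–Luce curve: $\psi_k(r)=\frac{\lambda r}{k+(\lambda-1)r}$, $r=0,\dots,k$. $\Pi_{\lambda,\gamma}(\boldsymbol m)=\frac1n\sum_i\psi_{k(\boldsymbol m)}(r_i(\boldsymbol m))-\gamma C(\boldsymbol m)$ for $\boldsymbol m\neq\boldsymbol 0$, $\Pi_{\lambda,\gamma}(\boldsymbol 0)=0$.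 $\mathrm{OPT}_{\lambda,\gamma}(\mathcal G)=\max\{\Pi_{\lambda,\gamma}(\boldsymbol m):\boldsymbol m\in\mathbb Z_+^{\mathcal G},k(\boldsymbol m)\le K_{\max}\}$. Increments and LP. $d_{\ell,k}=\psi_k(\ell)-\psi_k(\ell-1)$; $\widetilde\psi_k(r)=d_{k,k}r+\sum_{t=1}^{k-1}(d_{t,k}-d_{t+1,k})\min\{r,t\}$, $r\ge0$. For $z\ge0$ with $\sum_gz_g=k$, $F_k(z)=\frac1n\sum_i\widetilde\psi_k(\sum_ga_{ig}z_g)-\gamma\sum_gc_gz_g$; for finite $\mathcal M\subseteq\mathcal G$, $L_k(\mathcal M)$ is the maximum of $F_k$ over such $z$ supported on $\mathcal M$ (equivalently, the value of the size-$k$ LP relaxation: maximize $\frac1n\sum_i\sum_{\ell}d_{\ell,k}y_{i\ell}-\gamma\sum_gc_gz_g$ s.t. $\sum_\ell y_{i\ell}\le\sum_ga_{ig}z_g$, $y_{i\ell}\le y_{i,\ell-1}$, $\sum_gz_g=k$, $z\ge0$, $0\le y_{i\ell}\le1$). Rounding loss: $c^{\mathrm{PL}}_{k,\lambda}=1-\frac{k+\lambda-1}{\lambda\{k+(\lambda-1)(k-1)\}}$ and $\varepsilon_{\mathrm{rnd}}(\mathcal K,\lambda)=\frac1e\max_{k\in\mathcal K}c^{\mathrm{PL}}_{k,\lambda}$. Scores. For task prices $\mu\in\mathbb R_+^n$: $s_g(\mu)=\sum_i\mu_ia_{ig}-\gamma c_g$ and $P(\mu,\gamma)=\max_{g\in\mathcal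 G}s_g(\mu)$. Implicit dual for size $k$: minimize $\sum_{i=1}^n\xi_i+k\theta$ over $(\mu,\xi,\theta)$ subject to the explicit constraints $\xi_i+r\mu_i\ge\psi_k(r)/n$ ($i=1,\dots,n$, $r=0,\dots,k$), $0\le\mu_i\le d_{1,k}/n$, $0\le\xi_i\le1/n$, $-\gamma c_{\max}\le\theta\le d_{1,k}$, and the workflow constraints $s_g(\mu)\le\theta$ for all $g\in\mathcal G$. Algorithm (Ellipsoid-Based Dual-Guided Workflow Optimization). For each $k\in\mathcal K$: set $\tau_k=\varepsilon_{\mathrm{ell}}/(2k)$ and $\mathcal G_k^{\mathrm{rec}}=\varnothing$, and run the ellipsoid method (Grötschel–Lovász–Schrijver weak optimization from weak separation) on the implicit dual with optimization tolerance $\varepsilon_{\mathrm{ell}}/2$. At each iterate $(\mu^t,\xi^t,\theta^t)$: if an explicit constraint is violated, supply one such constraint as separating hyperplane. Otherwise make $m$ primitive pricing calls at prices $\mu^t$ with tolerance $\tau_k$ (a batch), let $g^t$ be the returned workflow with the highest score $s_g(\mu^t)$, add $g^t$ to $\mathcal G_k^{\mathrm{rec}}$; if $s_{g^t}(\mu^t)>\theta^t$, supply the constraint $s_{g^t}(\mu)\le\theta$ as separating hyperplane; otherwise supply the weak-separation certificate $P(\mu^t,\gamma)\le\theta^t+\tau_k$. When the ellipsoid routine stops, perform primal recovery: solve the size-$k$ LP relaxation restricted to $\mathcal M=\mathcal G_k^{\mathrm{rec}}$, and let $z^k$ (extended by zero) be the resulting recovered solution, such that $z^k\ge0$, $\sum_gz^k_g=k$,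 $F_k(z^k)\ge L_k(\mathcal G)-\varepsilon_{\mathrm{ell}}$. Then round: draw $G_1^k,\dots,G_k^k$ i.i.d. with $\Pr(G_j^k=g)=z_g^k/k$ and put $M^{\mathrm{RR}}_{k,g}=\sum_j\mathbf 1\{G^k_j=g\}$. Finally return $\widehat{\boldsymbol M}$, the vector with the largest value $\Pi_{\lambda,\gamma}$ among $\boldsymbol 0$, $\boldsymbol m^0$ and $\{\boldsymbol M_k^{\mathrm{RR}}:k\in\mathcal K\}$. A batch satisfies its weak-pricing guarantee if its retained workflow $g^t$ satisfies $s_{g^t}(\mu^t)\ge P(\mu^t,\gamma)-\tau_k$. Iteration bound. $N_{\mathrm{ell},k}(\varepsilon_{\mathrm{ell}})$ is a deterministic upper bound on the number of iterations of the ellipsoid routine for size $k$ before it reaches tolerance $\varepsilon_{\mathrm{ell}}/2$, and $N_{\mathrm{ell}}(\varepsilon_{\mathrm{ell}})=\sum_{k\in\mathcal K}N_{\mathrm{ell},k}(\varepsilon_{\mathrm{ell}})$; by classical ellipsoid complexity bounds this is $\sum_{k\in\mathcal K}\mathrm{poly}(n,k,B,\log(1/\varepsilon_{\mathrm{ell}}))$, where $B$ bounds the binary encoding length of the rational problem data. *)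

theory Defs
  imports "HOL-Probability.Probability" "HOL-Probability.Product_PMF"
begin

section \<open>Problem data, payoff and optimum\<close>

text \<open>
  Tasks are the elements of the finite type \<open>'n\<close> (so n is \<open>CARD('n)\<close>), and the workflow class
  is the finite type \<open>'g\<close>. The fields \<open>price\<close> and \<open>strength\<close> are the cost
  price gamma and the Plackett-Luce strength lambda.
\<close>

record ('n, 'g) workflow_problem =
  correct :: "'n \<Rightarrow> 'g \<Rightarrow> nat"
  cost :: "'g \<Rightarrow> real"
  cost_max :: real
  price :: real
  strength :: real

definition valid_problem :: "('n::finite, 'g::finite) workflow_problem \<Rightarrow> bool" where
  "valid_problem W \<longleftrightarrow>
     (\<forall>i g. correct W i g \<in> {0, 1}) \<and>
     (\<forall>g. 0 \<le> cost W g \<and> cost W g \<le> cost_max W) \<and>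
     0 \<le> price W \<and> 1 \<le> strength W"

text \<open>Binary encoding length of a fraction in lowest terms: a sign bit plus the lengths of
  numerator and denominator.\<close>

definition rat_encoding_length :: "rat \<Rightarrow> nat" where
  "rat_encoding_length q = (case quotient_of q of (a, b) \<Rightarrow>
     1 + nat \<lceil>log 2 (real_of_int \<bar>a\<bar> + 1)\<rceil> + nat \<lceil>log 2 (real_of_int b + 1)\<rceil>)"

definition encodable :: "nat \<Rightarrow> real \<Rightarrow> bool" where
  "encodable B x \<longleftrightarrow> (\<exists>q. x = of_rat q \<and> rat_encoding_length q \<le> B)"

text \<open>The class is given implicitly, so the bound applies to each datum and not to an explicit
  list of all workflows.\<close>

definition encoding_bound :: "('n::finite, 'g::finite) workflow_problem \<Rightarrow> nat \<Rightarrow> bool" where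
  "encoding_bound W B \<longleftrightarrow>
     (\<forall>i g. encodable B (real (correct W i g))) \<and> (\<forall>g. encodable B (cost W g)) \<and>
     encodable B (cost_max W) \<and> encodable B (price W) \<and> encodable B (strength W)"

definition psize :: "('g::finite \<Rightarrow> nat) \<Rightarrow> nat" where
  "psize m = (\<Sum>g\<in>UNIV. m g)"

definition psi :: "real \<Rightarrow> nat \<Rightarrow> nat \<Rightarrow> real" where
  "psi lam k r = lam * real r / (real k + (lam - 1) * real r)"

definition profit :: "('n::finite, 'g::finite) workflow_problem \<Rightarrow> ('g \<Rightarrow> nat) \<Rightarrow> real" where
  "profit W m = (if m = (\<lambda>_. 0) then 0 else
     (1 / real CARD('n)) * (\<Sum>i\<in>UNIV. psi (strength W) (psize m) (\<Sum>g\<in>UNIV. correct W i g * m g))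
     - price W * (\<Sum>g\<in>UNIV. cost W g * real (m g)))"

definition OPT :: "('n::finite, 'g::finite) workflow_problem \<Rightarrow> nat \<Rightarrow> real" where
  "OPT W Kmax = Max (profit W ` {m. psize m \<le> Kmax})"

section \<open>Increments, LP relaxation and rounding loss\<close>

definition incr :: "real \<Rightarrow> nat \<Rightarrow> nat \<Rightarrow> real" where
  "incr lam l k = psi lam k l - psi lam k (l - 1)"

definition psi_lin :: "real \<Rightarrow> nat \<Rightarrow> real \<Rightarrow> real" where
  "psi_lin lam k r = incr lam k k * r
     + (\<Sum>t = 1..<k. (incr lam t k - incr lam (t + 1) k) * min r (real t))"

definition lp_objective :: "('n::finite, 'g::finite) workflow_problem \<Rightarrow> nat \<Rightarrow> ('g \<Rightarrow> real) \<Rightarrow> real" where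
  "lp_objective W k z =
     (1 / real CARD('n)) * (\<Sum>i\<in>UNIV. psi_lin (strength W) k (\<Sum>g\<in>UNIV. real (correct W i g) * z g))
     - price W * (\<Sum>g\<in>UNIV. cost W g * z g)"

definition lp_feasible :: "nat \<Rightarrow> 'g::finite set \<Rightarrow> ('g \<Rightarrow> real) set" where
  "lp_feasible k M = {z. (\<forall>g. 0 \<le> z g) \<and> (\<Sum>g\<in>UNIV. z g) = real k \<and> (\<forall>g. g \<notin> M \<longrightarrow> z g = 0)}"

text \<open>Primal recovery: an optimal solution of the size-k LP relaxation restricted to \<open>M\<close>.
  Its near-optimality for the unrestricted relaxation is not built in.\<close>

definition recovered :: "('n::finite, 'g::finite) workflow_problem \<Rightarrow> nat \<Rightarrow> 'g set \<Rightarrow> 'g \<Rightarrow> real" where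
  "recovered W k M = arg_max (lp_objective W k) (\<lambda>z. z \<in> lp_feasible k M)"

definition c_PL :: "nat \<Rightarrow> real \<Rightarrow> real" where
  "c_PL k lam = 1 - (real k + lam - 1) / (lam * (real k + (lam - 1) * (real k - 1)))"

definition eps_rnd :: "nat set \<Rightarrow> real \<Rightarrow> real" where
  "eps_rnd K lam = (1 / exp 1) * Max ((\<lambda>k. c_PL k lam) ` K)"

section \<open>Scores and the implicit dual\<close>

definition score :: "('n::finite, 'g::finite) workflow_problem \<Rightarrow> real ^ 'n \<Rightarrow> 'g \<Rightarrow> real" where
  "score W \<mu> g = (\<Sum>i\<in>UNIV. \<mu> $ i * real (correct W i g)) - price W * cost W g"

definition best_score :: "('n::finite, 'g::finite) workflow_problem \<Rightarrow> real ^ 'n \<Rightarrow> real" where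
  "best_score W \<mu> = Max (range (score W \<mu>))"

text \<open>A dual point is a triple \<open>(\<mu>, \<xi>, \<theta>)\<close>. A pair \<open>(v, b)\<close> stands for the half-space
  \<open>v \<bullet> x \<le> b\<close>.\<close>

type_synonym 'n dual = "(real ^ 'n) \<times> (real ^ 'n) \<times> real"
type_synonym 'v halfspace = "'v \<times> real"

definition satisfies :: "'v::real_inner \<Rightarrow> 'v halfspace \<Rightarrow> bool" where
  "satisfies x c \<longleftrightarrow> fst c \<bullet> x \<le> snd c"

definition explicit_constraints ::
  "('n::finite, 'g::finite) workflow_problem \<Rightarrow> nat \<Rightarrow> 'n dual halfspace set" where
  "explicit_constraints W k =
     (let n = real CARD('n); d1 = incr (strength W) 1 k in
       {((- (real r *\<^sub>R axis i 1), - axis i 1, 0), - (psi (strength W) k r / n)) | i r. r \<le> k} \<union>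
       {((- axis i 1, 0, 0), 0) | i. True} \<union>
       {((axis i 1, 0, 0), d1 / n) | i. True} \<union>
       {((0, - axis i 1, 0), 0) | i. True} \<union>
       {((0, axis i 1, 0), 1 / n) | i. True} \<union>
       {((0, 0, - 1), price W * cost_max W), ((0, 0, 1), d1)})"

text \<open>The half-space of all dual points with \<open>score W \<mu> g \<le> \<theta>\<close>.\<close>

definition workflow_constraint ::
  "('n::finite, 'g::finite) workflow_problem \<Rightarrow> 'g \<Rightarrow> 'n dual halfspace" where
  "workflow_constraint W g = (((\<chi> i. real (correct W i g)), 0, - 1), price W * cost W g)"

text \<open>The dual of the size-k LP relaxation restricted to \<open>M\<close>; the implicit dual itself is the
  case \<open>M = UNIV\<close>.\<close>

definition dual_feasible ::
  "('n::finite, 'g::finite) workflow_problem \<Rightarrow> nat \<Rightarrow> 'g set \<Rightarrow> 'n dual set" where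
  "dual_feasible W k M =
     {x. \<forall>c \<in> explicit_constraints W k \<union> workflow_constraint W ` M. satisfies x c}"

definition dual_gradient :: "nat \<Rightarrow> ('n::finite) dual" where
  "dual_gradient k = (0, (\<chi> i. 1), real k)"

definition dual_objective :: "nat \<Rightarrow> ('n::finite) dual \<Rightarrow> real" where
  "dual_objective k x = (case x of (\<mu>, \<xi>, \<theta>) \<Rightarrow> (\<Sum>i\<in>UNIV. \<xi> $ i) + real k * \<theta>)"

section \<open>The ellipsoid method\<close>

text \<open>
  The central-cut ellipsoid method of Groetschel, Lovasz and Schrijver for weak optimization from
  weak separation, with sliding objective. A pair \<open>(x, A)\<close> is the ellipsoid with center \<open>x\<close> and
  positive definite shape matrix \<open>A\<close> (as a linear map). An answer to the query at the current
  center is either a violated inequality, whose normal is used as cut direction, or a certificate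
  of approximate feasibility, in which case the objective gradient is used. After each
  update all entries are cut at \<open>p\<close> binary digits; the factor \<open>(2d^2 + 3) / (2d^2)\<close> (instead of
  \<open>d^2 / (d^2 - 1)\<close>) compensates for this.
\<close>

datatype 'v answer = Hyperplane "'v halfspace" | Weak_Certificate

type_synonym 'v ellipsoid = "'v \<times> ('v \<Rightarrow> 'v)"

definition cut_digits :: "nat \<Rightarrow> real \<Rightarrow> real" where
  "cut_digits p t = real_of_int \<lfloor>2 ^ p * t\<rfloor> / 2 ^ p"

definition cut_ellipsoid :: "nat \<Rightarrow> 'v::euclidean_space ellipsoid \<Rightarrow> 'v ellipsoid" where
  "cut_ellipsoid p E = (case E of (x, A) \<Rightarrow>
     ((\<Sum>b\<in>Basis. cut_digits p (x \<bullet> b) *\<^sub>R b),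
      (\<lambda>v. \<Sum>b\<in>Basis. (\<Sum>b'\<in>Basis. cut_digits p (A b' \<bullet> b) * (v \<bullet> b')) *\<^sub>R b)))"

definition central_cut :: "'v::euclidean_space \<Rightarrow> 'v ellipsoid \<Rightarrow> 'v ellipsoid" where
  "central_cut a E = (case E of (x, A) \<Rightarrow>
     let d = real DIM('v); b = A a /\<^sub>R sqrt (a \<bullet> A a) in
       (x - b /\<^sub>R (d + 1),
        (\<lambda>v. ((2 * d\<^sup>2 + 3) / (2 * d\<^sup>2)) *\<^sub>R (A v - ((2 / (d + 1)) * (b \<bullet> v)) *\<^sub>R b))))"

definition cut_direction :: "'v \<Rightarrow> 'v answer \<Rightarrow> 'v" where
  "cut_direction grad ans = (case ans of Hyperplane c \<Rightarrow> fst c | Weak_Certificate \<Rightarrow> grad)"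

definition ellipsoid_after ::
  "nat \<Rightarrow> 'v::euclidean_space \<Rightarrow> 'v ellipsoid \<Rightarrow> 'v answer list \<Rightarrow> 'v ellipsoid" where
  "ellipsoid_after p grad E0 h =
     foldl (\<lambda>E ans. cut_ellipsoid p (central_cut (cut_direction grad ans) E)) E0 h"

text \<open>The initial ball contains every point satisfying the explicit constraints: there all
  coordinates of \<open>\<mu>\<close> and \<open>\<xi>\<close> lie between 0 and \<open>1 / n\<close>, and \<open>\<theta>\<close> lies between
  \<open>- price W * cost_max W\<close> and 1.\<close>

definition initial_ellipsoid :: "('n::finite, 'g::finite) workflow_problem \<Rightarrow> ('n dual) ellipsoid" where
  "initial_ellipsoid W = (0, (\<lambda>v. (3 + price W * cost_max W)\<^sup>2 *\<^sub>R v))"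

text \<open>The query point following the answers \<open>h\<close> (oldest first).\<close>

definition iterate ::
  "('n::finite, 'g::finite) workflow_problem \<Rightarrow> nat \<Rightarrow> nat \<Rightarrow> 'n dual answer list \<Rightarrow> 'n dual" where
  "iterate W p k h = fst (ellipsoid_after p (dual_gradient k) (initial_ellipsoid W) h)"

text \<open>Correctness of an answer to a query at \<open>x\<close>, as a weak separation oracle with slack
  \<open>tau\<close> for \<open>dual_feasible W k M\<close>.\<close>

definition valid_answer ::
  "('n::finite, 'g::finite) workflow_problem \<Rightarrow> nat \<Rightarrow> real \<Rightarrow> 'g set \<Rightarrow> 'n dual \<Rightarrow> 'n dual answer \<Rightarrow> bool" where
  "valid_answer W k tau M x ans = (case ans of
     Hyperplane c \<Rightarrow> c \<in> explicit_constraints W k \<union> workflow_constraint W ` M \<and> \<not> satisfies x c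
   | Weak_Certificate \<Rightarrow>
       (\<forall>c \<in> explicit_constraints W k. satisfies x c) \<and>
       (\<forall>g \<in> M. score W (fst x) g \<le> snd (snd x) + tau))"

definition valid_run ::
  "('n::finite, 'g::finite) workflow_problem \<Rightarrow> nat \<Rightarrow> ('n dual answer list \<Rightarrow> bool) \<Rightarrow> nat \<Rightarrow> real \<Rightarrow>
   'g set \<Rightarrow> 'n dual answer list \<Rightarrow> bool" where
  "valid_run W p stop k tau M h \<longleftrightarrow>
     (\<forall>t < length h. \<not> stop (take t h) \<and> valid_answer W k tau M (iterate W p k (take t h)) (h ! t))"

text \<open>Some certified iterate is optimal up to \<open>tol\<close> for the dual restricted to \<open>M\<close>.\<close>

definition tolerance_reached ::
  "('n::finite, 'g::finite) workflow_problem \<Rightarrow> nat \<Rightarrow> nat \<Rightarrow> real \<Rightarrow> 'g set \<Rightarrow> 'n dual answer list \<Rightarrow> bool" where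
  "tolerance_reached W p k tol M h \<longleftrightarrow>
     (\<exists>t < length h. h ! t = Weak_Certificate \<and>
        (\<forall>y \<in> dual_feasible W k M. dual_objective k (iterate W p k (take t h)) \<le> dual_objective k y + tol))"

text \<open>
  Weak optimization within tolerance \<open>eps / 2\<close>. The ellipsoid routine only sees the answers to
  its queries, and its precision and stopping rule are fixed by the dimension and the encoding
  length. Hence, when it stops, the tolerance is reached for the dual of every nonempty subclass
  \<open>M\<close> of workflows for which all answers were correct, not only for \<open>M = UNIV\<close>.
\<close>

definition ellipsoid_tolerance ::
  "('n::finite, 'g::finite) workflow_problem \<Rightarrow> nat \<Rightarrow> ('n dual answer list \<Rightarrow> bool) \<Rightarrow> nat \<Rightarrow> real \<Rightarrow> bool" where
  "ellipsoid_tolerance W p stop k eps \<longleftrightarrow>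
     (\<forall>M h. M \<noteq> {} \<and> valid_run W p stop k (eps / (2 * real k)) M h \<and> stop h
        \<longrightarrow> tolerance_reached W p k (eps / 2) M h)"

text \<open>Whatever the answers are, the routine stops after at most \<open>N\<close> of them.\<close>

definition iteration_bound :: "('v answer list \<Rightarrow> bool) \<Rightarrow> nat \<Rightarrow> bool" where
  "iteration_bound stop N \<longleftrightarrow> (\<forall>h. length h = N \<longrightarrow> (\<exists>t \<le> N. stop (take t h)))"

section \<open>Pricing calls and the pricing phase\<close>

text \<open>
  The query history lists all primitive pricing calls so far, over all sizes: prices, tolerance
  and returned workflow. A randomized pricing oracle is given by the conditional distribution of
  the returned workflow given the history and the current call.
\<close>

type_synonym ('n, 'g) history = "((real ^ 'n) \<times> real \<times> 'g) list"
type_synonym ('n, 'g) oracle_law = "('n, 'g) history \<Rightarrow> real ^ 'n \<Rightarrow> real \<Rightarrow> 'g pmf"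

definition pricing_guarantee ::
  "('n::finite, 'g::finite) workflow_problem \<Rightarrow> ('n, 'g) oracle_law \<Rightarrow> real \<Rightarrow> bool" where
  "pricing_guarantee W orc q \<longleftrightarrow>
     (\<forall>hist \<mu> \<delta>. (\<forall>i. 0 \<le> \<mu> $ i) \<and> 0 < \<delta> \<longrightarrow>
        measure_pmf.prob (orc hist \<mu> \<delta>) {g. score W \<mu> g \<ge> best_score W \<mu> - \<delta>} \<ge> q)"

primrec batch_calls ::
  "('n::finite, 'g) oracle_law \<Rightarrow> real ^ 'n \<Rightarrow> real \<Rightarrow> nat \<Rightarrow> ('n, 'g) history \<Rightarrow>
   ('g list \<times> ('n, 'g) history) pmf" where
  "batch_calls orc \<mu> \<delta> 0 hist = return_pmf ([], hist)"
| "batch_calls orc \<mu> \<delta> (Suc j) hist =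
     bind_pmf (orc hist \<mu> \<delta>) (\<lambda>g.
     bind_pmf (batch_calls orc \<mu> \<delta> j (hist @ [(\<mu>, \<delta>, g)])) (\<lambda>(gs, hist').
     return_pmf (g # gs, hist')))"

text \<open>State of an ellipsoid run: the answers so far, the batches so far (prices and retained
  workflow), and the query history.\<close>

type_synonym ('n, 'g) run_state =
  "'n dual answer list \<times> ((real ^ 'n) \<times> 'g) list \<times> ('n, 'g) history"

definition ellipsoid_step ::
  "('n::finite, 'g::finite) workflow_problem \<Rightarrow> ('n, 'g) oracle_law \<Rightarrow> nat \<Rightarrow> real \<Rightarrow>
   nat \<Rightarrow> ('n dual answer list \<Rightarrow> bool) \<Rightarrow> nat \<Rightarrow> ('n, 'g) run_state \<Rightarrow> ('n, 'g) run_state pmf" where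
  "ellipsoid_step W orc m eps p stop k st = (case st of (h, bs, hist) \<Rightarrow>
     if stop h then return_pmf (h, bs, hist)
     else let x = iterate W p k h; \<mu> = fst x; \<theta> = snd (snd x);
              violated = {c \<in> explicit_constraints W k. \<not> satisfies x c} in
       if violated \<noteq> {} then return_pmf (h @ [Hyperplane (SOME c. c \<in> violated)], bs, hist)
       else bind_pmf (batch_calls orc \<mu> (eps / (2 * real k)) m hist) (\<lambda>(gs, hist').
         let g = arg_max (score W \<mu>) (\<lambda>g. g \<in> set gs) in
         return_pmf
           (h @ [if score W \<mu> g > \<theta> then Hyperplane (workflow_constraint W g) else Weak_Certificate],
            bs @ [(\<mu>, g)], hist')))"

primrec repeat_step :: "nat \<Rightarrow> ('s \<Rightarrow> 's pmf) \<Rightarrow> 's \<Rightarrow> 's pmf" where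
  "repeat_step 0 f s = return_pmf s"
| "repeat_step (Suc j) f s = bind_pmf (f s) (repeat_step j f)"

text \<open>
  The runs for all sizes in turn; the result maps each size to its batches. The step leaves
  stopped states unchanged, so under \<open>iteration_bound (stop k) (N k)\<close> repeating it \<open>N k\<close> times
  runs the ellipsoid routine until it stops.
\<close>

primrec pricing_runs ::
  "('n::finite, 'g::finite) workflow_problem \<Rightarrow> ('n, 'g) oracle_law \<Rightarrow> nat \<Rightarrow> real \<Rightarrow>
   (nat \<Rightarrow> nat) \<Rightarrow> (nat \<Rightarrow> 'n dual answer list \<Rightarrow> bool) \<Rightarrow> (nat \<Rightarrow> nat) \<Rightarrow>
   nat list \<Rightarrow> ('n, 'g) history \<Rightarrow> (nat \<Rightarrow> ((real ^ 'n) \<times> 'g) list) pmf" where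
  "pricing_runs W orc m eps prec stop N [] hist = return_pmf (\<lambda>_. [])"
| "pricing_runs W orc m eps prec stop N (k # ks) hist =
     bind_pmf (repeat_step (N k) (ellipsoid_step W orc m eps (prec k) (stop k) k) ([], [], hist))
       (\<lambda>(h, bs, hist').
     bind_pmf (pricing_runs W orc m eps prec stop N ks hist') (\<lambda>R. return_pmf (R(k := bs))))"

definition pricing_phase ::
  "('n::finite, 'g::finite) workflow_problem \<Rightarrow> ('n, 'g) oracle_law \<Rightarrow> nat \<Rightarrow> real \<Rightarrow>
   (nat \<Rightarrow> nat) \<Rightarrow> (nat \<Rightarrow> 'n dual answer list \<Rightarrow> bool) \<Rightarrow> (nat \<Rightarrow> nat) \<Rightarrow>
   nat set \<Rightarrow> (nat \<Rightarrow> ((real ^ 'n) \<times> 'g) list) pmf" where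
  "pricing_phase W orc m eps prec stop N K =
     pricing_runs W orc m eps prec stop N (sorted_list_of_set K) []"

definition all_batches_ok ::
  "('n::finite, 'g::finite) workflow_problem \<Rightarrow> real \<Rightarrow> nat set \<Rightarrow>
   (nat \<Rightarrow> ((real ^ 'n) \<times> 'g) list) \<Rightarrow> bool" where
  "all_batches_ok W eps K R \<longleftrightarrow>
     (\<forall>k \<in> K. \<forall>(\<mu>, g) \<in> set (R k). score W \<mu> g \<ge> best_score W \<mu> - eps / (2 * real k))"

section \<open>Rounding and the returned portfolio\<close>

definition rounded :: "nat \<Rightarrow> ('g::finite \<Rightarrow> real) \<Rightarrow> ('g \<Rightarrow> nat) pmf" where
  "rounded k z = map_pmf (\<lambda>gs g. count_list gs g)
     (replicate_pmf k (embed_pmf (\<lambda>g. z g / real k)))"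

definition select_best ::
  "('n::finite, 'g::finite) workflow_problem \<Rightarrow> nat set \<Rightarrow> ('g \<Rightarrow> nat) \<Rightarrow> (nat \<Rightarrow> 'g \<Rightarrow> nat) \<Rightarrow> 'g \<Rightarrow> nat" where
  "select_best W K m0 MR = arg_max (profit W) (\<lambda>m. m \<in> {(\<lambda>_. 0), m0} \<union> MR ` K)"

text \<open>Law of the returned portfolio over the rounding step only, for a fixed outcome \<open>R\<close> of the
  pricing phase.\<close>

definition returned ::
  "('n::finite, 'g::finite) workflow_problem \<Rightarrow> nat set \<Rightarrow> ('g \<Rightarrow> nat) \<Rightarrow>
   (nat \<Rightarrow> ((real ^ 'n) \<times> 'g) list) \<Rightarrow> ('g \<Rightarrow> nat) pmf" where
  "returned W K m0 R = map_pmf (select_best W K m0)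
     (Pi_pmf K (\<lambda>_. 0) (\<lambda>k. rounded k (recovered W k (snd ` set (R k)))))"

definition E_rnd ::
  "('n::finite, 'g::finite) workflow_problem \<Rightarrow> nat set \<Rightarrow> ('g \<Rightarrow> nat) \<Rightarrow>
   (nat \<Rightarrow> ((real ^ 'n) \<times> 'g) list) \<Rightarrow> real" where
  "E_rnd W K m0 R = measure_pmf.expectation (returned W K m0 R) (profit W)"

definition coverage :: "nat \<Rightarrow> nat set \<Rightarrow> real \<Rightarrow> bool" where
  "coverage Kmax K \<rho> \<longleftrightarrow> (\<forall>k \<in> {1..Kmax}. \<exists>b \<in> K. b \<le> k \<and> real k \<le> \<rho> * real b)"

end

(* Three losses are controlled separately. Grid: scaling an optimal portfolio of size k* to a grid size
   b with b <= k* <= rho b keeps at least the fraction 1 / rho of its profit in the size-b relaxation.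
   Pricing: an answer that is valid for all workflows is also valid for the recorded subclass, so the
   stopped ellipsoid run approximates the dual of the restricted relaxation while its point is nearly
   feasible for the full dual; strong duality for the restricted relaxation then bounds the full
   relaxation. Rounding: the Plackett-Luce curve is a positive combination of the functions min(x, t),
   and each loses at most the factor 1 - 1/e, except for the linear part, which loses nothing.
   A batch fails with probability at most (1 - p)^m, and there are at most N_ell batches. *)

theory Submission
  imports Defs
begin

section \<open>The Plackett-Luce curve and its interpolation\<close>

text \<open>The pricing tolerance \<open>eps / (2 * k)\<close> comes from the dual objective: a
  slack in the scores is repaired by raising \<theta>, which has coefficient \<open>k\<close>, so it
  costs \<open>eps / 2\<close>; the weak optimization takes the other half. The dual constrains the
  curve at integers only, while LP loads are real. This is harmless because \<open>psi_lin\<close>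
  is affine between consecutive integers. The factor 1 - 1/e arises by comparing min(x, t) with the
  number of occupied boxes, whose mean under independent draws is explicit. The two sources of
  randomness stay apart: for every possible outcome of the pricing phase with successful batches,
  the profit bounds hold for the expectation over rounding alone. The success probability therefore
  concerns batches only, and it can be bounded despite adaptive queries because the pricing
  guarantee holds given any history.\<close>

lemma psi_denominator_pos:
  assumes "1 \<le> lam" "1 \<le> k"
  shows "0 < real k + (lam - 1) * real r"
  using assms by (simp add: add_pos_nonneg)

lemma psi_0 [simp]: "psi lam k 0 = 0"
  by (simp add: psi_def)

lemma psi_full: "1 \<le> lam \<Longrightarrow> 1 \<le> k \<Longrightarrow> psi lam k k = 1"
  using psi_denominator_pos[of lam k k] by (simp add: psi_def algebra_simps)

text \<open>In the numerator the terms quadratic in \<open>l\<close> cancel and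
  \<open>lam * k\<close> remains, so \<open>l\<close> enters through the denominator alone.\<close>

lemma incr_Suc:
  assumes "1 \<le> lam" "1 \<le> k"
  shows "incr lam (Suc l) k =
    lam * real k / ((real k + (lam - 1) * real (Suc l)) * (real k + (lam - 1) * real l))"
  using psi_denominator_pos[OF assms, of l] psi_denominator_pos[OF assms, of "Suc l"]
  unfolding incr_def psi_def by (simp add: divide_simps) (simp add: algebra_simps)

lemma incr_nonneg: "1 \<le> lam \<Longrightarrow> 1 \<le> k \<Longrightarrow> 0 \<le> incr lam l k"
  \<comment> \<open>For \<open>l = 0\<close> truncated subtraction turns the increment into
    \<open>psi lam k 0 - psi lam k 0\<close>.\<close>
  by (cases l) (simp_all add: incr_def[of _ 0] incr_Suc)

text \<open>Consecutive denominators share a factor, so only the outer factors \<open>?q j\<close>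
  and \<open>?q (Suc (Suc j))\<close> are compared. This concavity makes the weights of the
  functions \<open>min r t\<close> nonnegative.\<close>

lemma incr_decreasing:
  assumes "1 \<le> lam" "1 \<le> k" "1 \<le> l"
  shows "incr lam (l + 1) k \<le> incr lam l k"
proof -
  obtain j where l: "l = Suc j" using assms by (cases l) auto
  let ?q = "\<lambda>r::nat. real k + (lam - 1) * real r"
  have pos: "0 < ?q r" for r by (rule psi_denominator_pos[OF assms(1,2)])
  have "?q j \<le> ?q (Suc (Suc j))" using assms by (intro add_left_mono mult_left_mono) auto
  then have "?q (Suc j) * ?q j \<le> ?q (Suc (Suc j)) * ?q (Suc j)"
    using pos[of "Suc j"] mult_left_mono[of "?q j" "?q (Suc (Suc j))" "?q (Suc j)"]
    by (simp add: mult.commute)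
  then show ?thesis
    using assms pos mult_pos_pos[OF pos[of "Suc j"] pos[of j]]
    by (simp only: l Suc_eq_plus1[symmetric] incr_Suc) (rule divide_left_mono, auto)
qed

lemma psi_mono:
  assumes "1 \<le> lam" "1 \<le> k" "r \<le> s"
  shows "psi lam k r \<le> psi lam k s"
  using assms(3)
proof (induction rule: dec_induct)
  case (step j)
  then show ?case using incr_nonneg[OF assms(1,2), of "Suc j"] by (simp add: incr_def)
qed simp

lemma psi_le_1: "1 \<le> lam \<Longrightarrow> 1 \<le> k \<Longrightarrow> r \<le> k \<Longrightarrow> psi lam k r \<le> 1"
  using psi_mono[of lam k r k] by (simp add: psi_full)

text \<open>From \<open>r\<close> to \<open>Suc r\<close> only the terms with \<open>t > r\<close>
  still grow. Their weights telescope to \<open>incr lam (Suc r) k - incr lam k k\<close>, and the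
  linear part supplies the missing \<open>incr lam k k\<close>.\<close>

lemma psi_lin_of_nat:
  assumes "r \<le> k"
  shows "psi_lin lam k (real r) = psi lam k r"
  using assms
proof (induction r)
  case 0
  then show ?case by (simp add: psi_lin_def)
next
  case (Suc r)
  define w where "w t = incr lam t k - incr lam (t + 1) k" for t
  have psi: "psi_lin lam k u = incr lam k k * u + (\<Sum>t = 1..<k. w t * min u (real t))" for u
    by (simp add: psi_lin_def w_def)
  have "psi_lin lam k (real (Suc r)) - psi_lin lam k (real r) =
      incr lam k k + (\<Sum>t = 1..<k. w t * (min (real (Suc r)) (real t) - min (real r) (real t)))"
    by (simp add: psi algebra_simps flip: sum_subtractf)
  also have "(\<Sum>t = 1..<k. w t * (min (real (Suc r)) (real t) - min (real r) (real t)))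
      = (\<Sum>t = Suc r..<k. w t)"
    by (rule sum.mono_neutral_cong_right) (auto simp: min_def)
  also have "\<dots> = incr lam (Suc r) k - incr lam k k"
    using sum_Suc_diff'[of "Suc r" k "\<lambda>t. - incr lam t k"] Suc.prems by (simp add: w_def)
  finally show ?case using Suc by (simp add: incr_def)
qed

text \<open>Each \<open>min u t\<close> has its kink at the integer \<open>t\<close>, so nothing
  bends between \<open>r\<close> and \<open>Suc r\<close>.\<close>

lemma psi_lin_interpolates:
  assumes "0 \<le> e" "0 \<le> f" "e + f = 1"
  shows "psi_lin lam k (e * real r + f * real (Suc r))
    = e * psi_lin lam k (real r) + f * psi_lin lam k (real (Suc r))"
proof -
  define w where "w t = incr lam t k - incr lam (t + 1) k" for t
  have psi: "psi_lin lam k u = incr lam k k * u + (\<Sum>t = 1..<k. w t * min u (real t))" for u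
    by (simp add: psi_lin_def w_def)
  have e: "e = 1 - f" using assms by simp
  have "min (e * real r + f * real (Suc r)) (real t) = e * min (real r) (real t) + f * min (real (Suc r)) (real t)" for t
    using assms(1,2) unfolding e by (cases "t \<le> r") (auto simp: min_def algebra_simps)
  then show ?thesis
    by (simp add: psi algebra_simps sum.distrib sum_distrib_left del: of_nat_Suc)
qed

text \<open>Reduces a claim about real loads to integer values of the curve. The separate bound
  \<open>R\<close> allows a smaller range than the size \<open>k\<close>, as in the comparison of
  two sizes.\<close>

lemma psi_lin_between:
  assumes "0 \<le> u" "u \<le> real R" "R \<le> k"
  obtains r s e f where "r \<le> R" "s \<le> R" "0 \<le> e" "0 \<le> f" "e + f = 1" "u = e * real r + f * real s"
    "psi_lin lam k u = e * psi lam k r + f * psi lam k s"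
proof (cases "u = real R")
  case True
  then show ?thesis using that[of R R 1 0] assms by (simp add: psi_lin_of_nat)
next
  case False
  define r where "r = nat \<lfloor>u\<rfloor>"
  have r: "real r \<le> u" "u < real r + 1" using assms by (auto simp: r_def)
  define f where "f = u - real r"
  have "real r < real R" using r(1) False assms(2) by linarith
  then have R: "Suc r \<le> R" by simp
  have u: "u = (1 - f) * real r + f * real (Suc r)" by (simp add: f_def algebra_simps)
  have "psi_lin lam k u = (1 - f) * psi lam k r + f * psi lam k (Suc r)"
    using psi_lin_interpolates[of "1 - f" f lam k r] r R assms(3)
    by (simp add: f_def psi_lin_of_nat flip: u[unfolded f_def] del: of_nat_Suc)
  with u r R show ?thesis by (intro that[of r "Suc r" "1 - f" f]) (auto simp: f_def)
qed

lemma psi_lin_concave: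
  assumes "1 \<le> lam" "1 \<le> k" "0 \<le> a" "0 \<le> b" "a + b = 1"
  shows "a * psi_lin lam k x + b * psi_lin lam k y \<le> psi_lin lam k (a * x + b * y)"
proof -
  define w where "w t = incr lam t k - incr lam (t + 1) k" for t
  have psi: "psi_lin lam k u = incr lam k k * u + (\<Sum>t = 1..<k. w t * min u (real t))" for u
    by (simp add: psi_lin_def w_def)
  have "a * min x t + b * min y t \<le> min (a * x + b * y) t" for t
    using assms mult_left_mono[of "min x t" x a] mult_left_mono[of "min y t" y b]
      mult_left_mono[of "min x t" t a] mult_left_mono[of "min y t" t b] distrib_right[of a b t]
    by simp
  then have "(\<Sum>t = 1..<k. w t * (a * min x (real t) + b * min y (real t)))
      \<le> (\<Sum>t = 1..<k. w t * min (a * x + b * y) (real t))"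
    using incr_decreasing[OF assms(1,2)] by (intro sum_mono mult_left_mono) (auto simp: w_def)
  then show ?thesis
    by (simp add: psi algebra_simps sum.distrib sum_distrib_left)
qed

text \<open>Left of 0 every \<open>min u t\<close> equals \<open>u\<close>, so the weights add up to
  the first increment. The behavior here and beyond \<open>k\<close> later confines the separating
  prices to the box of the explicit constraints.\<close>

lemma psi_lin_nonpos:
  assumes "1 \<le> k" "u \<le> 0"
  shows "psi_lin lam k u = incr lam 1 k * u"
proof -
  have "(\<Sum>t = 1..<k. (incr lam t k - incr lam (t + 1) k) * min u (real t))
      = (\<Sum>t = 1..<k. incr lam t k - incr lam (Suc t) k) * u"
    using assms by (simp add: sum_distrib_right min_def)
  also have "(\<Sum>t = 1..<k. incr lam t k - incr lam (Suc t) k) = incr lam 1 k - incr lam k k"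
    using sum_Suc_diff'[of 1 k "\<lambda>t. - incr lam t k"] assms by simp
  finally show ?thesis by (simp add: psi_lin_def algebra_simps)
qed

lemma psi_lin_beyond:
  assumes "1 \<le> k" "real k \<le> u"
  shows "psi_lin lam k u = psi lam k k + incr lam k k * (u - real k)"
proof -
  have "psi_lin lam k u - psi_lin lam k (real k) = incr lam k k * (u - real k)"
    using assms by (simp add: psi_lin_def algebra_simps min_def cong: sum.cong_simp)
  then show ?thesis by (simp add: psi_lin_of_nat)
qed

text \<open>Comparison of two sizes: below \<open>r\<close> every chord slope \<open>psi lam b y / y\<close> is at least
  \<open>lam / (k + (lam - 1) * r)\<close>, and interpolation preserves this.\<close>

lemma psi_lin_scaled:
  assumes "1 \<le> lam" "1 \<le> b" "b \<le> k" "r \<le> k"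
  shows "real b / real k * psi lam k r \<le> psi_lin lam b (real b / real k * real r)"
proof -
  define s where "s = lam / (real k + (lam - 1) * real r)"
  have slope: "s * real y \<le> psi lam b y" if "y \<le> r" for y
  proof -
    have "real b + (lam - 1) * real y \<le> real k + (lam - 1) * real r"
      using assms that by (intro add_mono mult_left_mono) auto
    then have "s \<le> lam / (real b + (lam - 1) * real y)"
      unfolding s_def using assms psi_denominator_pos[of lam b y]
      by (intro divide_left_mono mult_pos_pos) auto
    from mult_right_mono[OF this, of "real y"] show ?thesis by (simp add: psi_def)
  qed
  let ?u = "real b / real k * real r"
  have le: "real b * real r \<le> real k * real r" "real b * real r \<le> real b * real k"
    using assms by (auto intro: mult_right_mono mult_left_mono)
  then have "?u \<le> real b" "?u \<le> real r" using assms by (auto simp: divide_simps mult.commute)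
  \<comment> \<open>The slope estimate covers integers up to \<open>r\<close>, the agreement of
    \<open>psi_lin lam b\<close> with the curve those up to \<open>b\<close>.\<close>
  then have "?u \<le> real (min b r)" by (simp only: of_nat_min min.bounded_iff)
  then obtain x y e f where xy: "x \<le> min b r" "y \<le> min b r" "0 \<le> e" "0 \<le> f" "e + f = 1"
    "?u = e * real x + f * real y"
    "psi_lin lam b ?u = e * psi lam b x + f * psi lam b y"
    by (rule psi_lin_between[of ?u "min b r" b lam, rotated 1]) auto
  \<comment> \<open>At \<open>r\<close> itself the chord slope of \<open>psi lam k\<close> is
    exactly \<open>s\<close>.\<close>
  have "real b / real k * psi lam k r = s * ?u" by (simp add: psi_def s_def mult_ac)
  also have "\<dots> = e * (s * real x) + f * (s * real y)" by (simp only: xy(6)) algebra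
  also have "\<dots> \<le> psi_lin lam b ?u"
    unfolding xy(7) using xy by (intro add_mono mult_left_mono slope) auto
  finally show ?thesis .
qed

text \<open>\<open>c_PL\<close> is the curvature 1 - d_k / d_1 of the last increment d_k =
  \<open>1 / D\<close> and the first increment d_1 = lam / (k + lam - 1). Replacing 1 / d_1 by the
  larger \<open>k\<close> gives the first claim; that comparison is (lam - 1) * (k - 1) \<ge>
  0.\<close>

lemma c_PL_ge:
  assumes "1 \<le> lam" "1 \<le> k"
  shows "1 - real k * incr lam k k \<le> c_PL k lam" "0 \<le> c_PL k lam"
proof -
  define D where "D = real k + (lam - 1) * (real k - 1)"
  have D: "1 \<le> D" "real k \<le> D" using assms unfolding D_def by (auto intro: add_increasing2)
  obtain j where j: "k = Suc j" using assms by (cases k) auto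
  have incr: "incr lam k k = 1 / D"
    using assms psi_denominator_pos[of lam k k]
    unfolding j incr_Suc[OF assms(1), of "Suc j" j, simplified] D_def
    by (simp add: divide_simps) (simp add: algebra_simps)
  have c: "c_PL k lam = 1 - (real k + lam - 1) / lam / D" by (simp add: c_PL_def D_def)
  have "0 \<le> (lam - 1) * (real k - 1)" using assms by simp
  then have le: "(real k + lam - 1) / lam \<le> real k"
    using assms by (simp add: divide_simps algebra_simps)
  then have 1: "(real k + lam - 1) / lam / D \<le> real k / D"
    using D by (intro divide_right_mono) auto
  then show "1 - real k * incr lam k k \<le> c_PL k lam" by (simp add: incr c)
  have "real k / D \<le> 1" using D by simp
  with 1 show "0 \<le> c_PL k lam" by (simp add: c)
qed

section \<open>Rounding\<close>

text \<open>Throwing the successes into \<open>t\<close> boxes: the expected number \<open>t * (1 - (1 - 1 / t) ^ x)\<close> of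
  occupied boxes is at most \<open>min x t\<close>.\<close>

lemma occupied_boxes_le_min:
  assumes "1 \<le> t"
  shows "real t * (1 - (1 - 1 / real t) ^ x) \<le> min (real x) (real t)"
proof -
  have "1 + real x * (- 1 / real t) \<le> (1 + (- 1 / real t)) ^ x"
    using assms by (intro Bernoulli_inequality) auto
  then have "real t * (1 - (1 - 1 / real t) ^ x) \<le> real t * (real x / real t)"
    by (intro mult_left_mono) auto
  moreover have "0 \<le> (1 - 1 / real t) ^ x" using assms by simp
  ultimately show ?thesis using assms by (auto simp: algebra_simps)
qed

text \<open>On [0, 1] the concave right side lies above its chord; past 1 it keeps growing while the
  left side stays at its value at 1.\<close>

lemma one_minus_exp_ge:
  assumes "0 \<le> (y::real)"
  shows "(1 - 1 / exp 1) * min y 1 \<le> 1 - exp (- y)"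
proof (cases "y \<le> 1")
  case True
  have "convex_on UNIV (exp :: real \<Rightarrow> real)" by (rule exp_convex)
  from convex_onD[OF this, of y 0 "- 1"] assms True
  show ?thesis by (simp add: exp_minus divide_simps algebra_simps)
next
  case False
  then show ?thesis by (simp add: exp_minus divide_simps) (simp add: algebra_simps)
qed

lemma boxes_ge:
  assumes "1 \<le> t" "1 \<le> k" "0 \<le> q" "q \<le> 1"
  shows "(1 - 1 / exp 1) * min (real k * q) (real t) \<le> real t * (1 - (1 - q / real t) ^ k)"
proof -
  have "1 - q / real t \<le> exp (- (q / real t))" using exp_ge_add_one_self[of "- (q / real t)"] by simp
  moreover have "q / real t \<le> 1" using assms by simp
  ultimately have "(1 - q / real t) ^ k \<le> exp (- (q / real t)) ^ k" by (intro power_mono) auto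
  also have "\<dots> = exp (- (real k * q / real t))" by (simp flip: exp_of_nat_mult)
  finally have "(1 - 1 / exp 1) * min (real k * q / real t) 1 \<le> 1 - (1 - q / real t) ^ k"
    using one_minus_exp_ge[of "real k * q / real t"] assms by simp
  from mult_left_mono[OF this, of "real t"]
  have "(1 - 1 / exp 1) * (real t * min (real k * q / real t) 1) \<le> real t * (1 - (1 - q / real t) ^ k)"
    by (simp add: mult_ac)
  moreover have "real t * min (real k * q / real t) 1 = min (real k * q) (real t)"
    using assms by (auto simp: min_def divide_simps)
  ultimately show ?thesis by simp
qed

section \<open>Expectations over lists of independent draws\<close>

lemma finite_set_replicate_pmf: "finite (set_pmf (replicate_pmf k (p :: 'a::finite pmf)))"
  by (rule finite_subset[OF _ finite_lists_length_eq[of "UNIV :: 'a set" k]])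
    (auto simp: set_replicate_pmf)

lemma expectation_replicate_pmf_Suc:
  fixes p :: "'a::finite pmf" and f :: "'a list \<Rightarrow> real"
  shows "measure_pmf.expectation (replicate_pmf (Suc k) p) f =
    measure_pmf.expectation p (\<lambda>x. measure_pmf.expectation (replicate_pmf k p) (\<lambda>xs. f (x # xs)))"
proof -
  have "replicate_pmf (Suc k) p = bind_pmf p (\<lambda>x. map_pmf ((#) x) (replicate_pmf k p))"
    by (simp add: map_pmf_def)
  then show ?thesis
    by (simp add: pmf_expectation_bind[of UNIV] finite_set_replicate_pmf integral_measure_pmf[of UNIV]
        del: replicate_pmf.simps)
qed

lemma expectation_sum_list_replicate_pmf:
  fixes f :: "'a::finite \<Rightarrow> real"
  shows "measure_pmf.expectation (replicate_pmf k p) (\<lambda>xs. sum_list (map f xs))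
    = real k * measure_pmf.expectation p f"
proof (induction k)
  case (Suc k)
  then show ?case
    by (simp add: expectation_replicate_pmf_Suc integrable_measure_pmf_finite finite_set_replicate_pmf
        algebra_simps del: replicate_pmf.simps)
qed simp

lemma expectation_prod_list_replicate_pmf:
  fixes f :: "'a::finite \<Rightarrow> real"
  shows "measure_pmf.expectation (replicate_pmf k p) (\<lambda>xs. prod_list (map f xs))
    = measure_pmf.expectation p f ^ k"
  by (induction k) (simp_all add: expectation_replicate_pmf_Suc del: replicate_pmf.simps(2))

text \<open>Occupied boxes serve as a lower bound for \<open>min\<close> because the chance that a
  box is missed is a product over the draws, so its expectation is exactly the power
  \<open>(1 - q / t) ^ k\<close>.\<close>

lemma expected_min_ge:
  fixes p :: "'a::finite pmf" and a :: "'a \<Rightarrow> nat"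
  assumes "\<And>x. a x \<in> {0, 1}" "1 \<le> k" "1 \<le> t"
  defines "q \<equiv> measure_pmf.expectation p (\<lambda>x. real (a x))"
  shows "(1 - 1 / exp 1) * min (real k * q) (real t)
    \<le> measure_pmf.expectation (replicate_pmf k p) (\<lambda>xs. min (real (sum_list (map a xs))) (real t))"
proof -
  have int: "integrable p f" for f :: "'a \<Rightarrow> real"
    by (simp add: integrable_measure_pmf_finite)
  have int': "integrable (replicate_pmf k p) f" for f :: "'a list \<Rightarrow> real"
    by (simp add: integrable_measure_pmf_finite finite_set_replicate_pmf)
  have "real (a x) \<le> 1" for x using assms(1)[of x] by auto
  then have "q \<le> 1" unfolding q_def using int by (intro measure_pmf.integral_le_const) auto
  have "0 \<le> q" unfolding q_def by simp
  \<comment> \<open>The exponent is 0 or 1, so the power is affine in \<open>a x\<close> and its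
    mean depends on \<open>q\<close> alone.\<close>
  have "(1 - 1 / real t) ^ a x = 1 - real (a x) / real t" for x using assms(1)[of x] by auto
  then have E: "measure_pmf.expectation p (\<lambda>x. (1 - 1 / real t) ^ a x) = 1 - q / real t"
    by (simp add: int q_def)
  have "prod_list (map (\<lambda>x. (1 - 1 / real t) ^ a x) xs) = (1 - 1 / real t) ^ sum_list (map a xs)" for xs
    by (induction xs) (simp_all add: power_add)
  then have "measure_pmf.expectation (replicate_pmf k p) (\<lambda>xs. (1 - 1 / real t) ^ sum_list (map a xs))
      = (1 - q / real t) ^ k"
    using expectation_prod_list_replicate_pmf[of k p "\<lambda>x. (1 - 1 / real t) ^ a x"] by (simp add: E)
  then have "real t * (1 - (1 - q / real t) ^ k) =
      measure_pmf.expectation (replicate_pmf k p) (\<lambda>xs. real t * (1 - (1 - 1 / real t) ^ sum_list (map a xs)))"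
    by (simp add: int')
  also have "\<dots> \<le> measure_pmf.expectation (replicate_pmf k p) (\<lambda>xs. min (real (sum_list (map a xs))) (real t))"
    by (intro integral_mono int' occupied_boxes_le_min assms)
  finally show ?thesis
    using boxes_ge[OF assms(3,2) \<open>0 \<le> q\<close> \<open>q \<le> 1\<close>] by linarith
qed

text \<open>Only the part \<open>G\<close> of \<open>psi_lin\<close> in excess of its smallest slope loses anything in the
  rounding, and \<open>G\<close> is at most \<open>c_PL\<close> there.\<close>

lemma expected_psi_ge:
  fixes p :: "'a::finite pmf" and a :: "'a \<Rightarrow> nat"
  assumes a: "\<And>x. a x \<in> {0, 1}" and k: "1 \<le> k" and lam: "1 \<le> lam"
  defines "q \<equiv> measure_pmf.expectation p (\<lambda>x. real (a x))"
  shows "psi_lin lam k (real k * q) - c_PL k lam / exp 1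
    \<le> measure_pmf.expectation (replicate_pmf k p) (\<lambda>xs. psi lam k (sum_list (map a xs)))"
proof -
  define w where "w t = incr lam t k - incr lam (t + 1) k" for t
  have w: "0 \<le> w t" if "t \<in> {1..<k}" for t
    using that incr_decreasing[OF lam k] by (simp add: w_def)
  define G where "G u = (\<Sum>t = 1..<k. w t * min u (real t))" for u
  have psi: "psi_lin lam k u = incr lam k k * u + G u" for u
    by (simp add: psi_lin_def w_def G_def)
  let ?E = "measure_pmf.expectation (replicate_pmf k p)"
  let ?X = "\<lambda>xs. sum_list (map a xs)"
  have int: "integrable (replicate_pmf k p) f" for f :: "'a list \<Rightarrow> real"
    by (simp add: integrable_measure_pmf_finite finite_set_replicate_pmf)
  have EX: "?E (\<lambda>xs. real (?X xs)) = real k * q"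
    using expectation_sum_list_replicate_pmf[of k p "\<lambda>x. real (a x)"]
    by (simp add: q_def o_def flip: sum_list_of_nat)
  have "?X xs \<le> length xs" for xs
  proof (induction xs)
    case (Cons x xs)
    then show ?case using a[of x] by auto
  qed simp
  then have "?X xs \<le> k" if "xs \<in> set_pmf (replicate_pmf k p)" for xs
    using that by (force simp: set_replicate_pmf)
  then have "?E (\<lambda>xs. psi lam k (?X xs)) = ?E (\<lambda>xs. psi_lin lam k (real (?X xs)))"
    by (intro integral_cong_AE) (auto simp: AE_measure_pmf_iff psi_lin_of_nat)
  also have "\<dots> = incr lam k k * (real k * q) + (\<Sum>t = 1..<k. w t * ?E (\<lambda>xs. min (real (?X xs)) (real t)))"
    by (simp add: psi G_def int EX)
  also have "\<dots> \<ge> incr lam k k * (real k * q) + (\<Sum>t = 1..<k. w t * ((1 - 1 / exp 1) * min (real k * q) (real t)))"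
    unfolding q_def using a k w by (intro add_left_mono sum_mono mult_left_mono expected_min_ge) auto
  also have "(\<Sum>t = 1..<k. w t * ((1 - 1 / exp 1) * min (real k * q) (real t))) = (1 - 1 / exp 1) * G (real k * q)"
    by (simp add: G_def sum_distrib_left mult_ac)
  also have "incr lam k k * (real k * q) + (1 - 1 / exp 1) * G (real k * q)
      = psi_lin lam k (real k * q) - G (real k * q) / exp 1"
    by (simp add: psi algebra_simps)
  finally have *: "psi_lin lam k (real k * q) - G (real k * q) / exp 1 \<le> ?E (\<lambda>xs. psi lam k (?X xs))" .
  have "real (a x) \<le> 1" for x using a[of x] by auto
  then have "q \<le> 1" unfolding q_def
    by (intro measure_pmf.integral_le_const) (auto simp: integrable_measure_pmf_finite)
  then have "real k * q \<le> real k * 1" by (intro mult_left_mono) auto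
  then have "G (real k * q) \<le> G (real k)"
    unfolding G_def using w by (intro sum_mono mult_left_mono) auto
  also have "\<dots> = 1 - real k * incr lam k k"
    using psi[of "real k"] by (simp add: psi_lin_of_nat psi_full[OF lam k] mult.commute)
  also have "\<dots> \<le> c_PL k lam" by (rule c_PL_ge[OF lam k])
  finally have "G (real k * q) / exp 1 \<le> c_PL k lam / exp 1" by (simp add: divide_right_mono)
  with * show ?thesis by linarith
qed

text \<open>Passes from multiplicity vectors, in which \<open>profit\<close> is stated, to lists of
  draws, on which expectations are computed.\<close>

lemma sum_count_list_eq_sum_list:
  fixes f :: "'a::finite \<Rightarrow> 'b::comm_semiring_1"
  shows "(\<Sum>x\<in>UNIV. f x * of_nat (count_list xs x)) = sum_list (map f xs)"
proof (induction xs)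
  case (Cons y xs)
  have "(\<Sum>x\<in>UNIV. f x * of_nat (count_list (y # xs) x))
      = (\<Sum>x\<in>UNIV. f x * of_nat (count_list xs x) + (if x = y then f x else 0))"
    by (intro sum.cong) (auto simp: algebra_simps)
  with Cons show ?case by (simp add: sum.distrib add.commute)
qed simp

lemma finite_set_rounded: "finite (set_pmf (rounded k z))"
  by (simp add: rounded_def finite_set_replicate_pmf)

text \<open>Every rounded portfolio has size exactly \<open>k\<close>, so one curve applies
  throughout, and the cost is additive over the draws and keeps its mean. Only the loss per task
  remains, averaged over the tasks.\<close>

lemma expected_profit_rounded:
  fixes W :: "('n::finite, 'g::finite) workflow_problem"
  assumes W: "valid_problem W" and k: "1 \<le> k" and z: "z \<in> lp_feasible k M"
  shows "lp_objective W k z - c_PL k (strength W) / exp 1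
    \<le> measure_pmf.expectation (rounded k z) (profit W)"
proof -
  let ?lam = "strength W"
  have lam: "1 \<le> ?lam" and a: "correct W i g \<in> {0, 1}" for i g
    using W by (auto simp: valid_problem_def)
  define p where "p = embed_pmf (\<lambda>g. z g / real k)"
  have zk: "(\<Sum>g\<in>UNIV. z g / real k) = 1" "\<And>g. 0 \<le> z g / real k"
    using z k by (auto simp: lp_feasible_def simp flip: sum_divide_distrib)
  have "(\<integral>\<^sup>+ g. ennreal (z g / real k) \<partial>count_space UNIV) = 1"
    using zk by (simp add: nn_integral_count_space_finite sum_ennreal)
  then have pmf_p: "pmf p g = z g / real k" for g
    unfolding p_def using zk by (intro pmf_embed_pmf) auto
  have Ep: "real k * measure_pmf.expectation p f = (\<Sum>g\<in>UNIV. f g * z g)" for f :: "'g \<Rightarrow> real"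
    using k by (simp add: integral_measure_pmf[of UNIV] pmf_p sum_distrib_left mult.commute)
  let ?E = "measure_pmf.expectation (replicate_pmf k p)"
  have int: "integrable (replicate_pmf k p) f" for f :: "'g list \<Rightarrow> real"
    by (simp add: integrable_measure_pmf_finite finite_set_replicate_pmf)
  let ?pay = "\<lambda>gs. (1 / real CARD('n)) * (\<Sum>i\<in>UNIV. psi ?lam k (sum_list (map (correct W i) gs)))
      - price W * sum_list (map (cost W) gs)"
  have profit: "profit W (count_list gs) = ?pay gs" if "gs \<in> set_pmf (replicate_pmf k p)" for gs
  proof -
    have len: "length gs = k" using that by (auto simp: set_replicate_pmf)
    then have size: "psize (count_list gs) = k"
      using sum_count_list_eq_sum_list[of "\<lambda>_. 1 :: nat" gs] by (simp add: psize_def sum_list_triv)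
    then have "count_list gs \<noteq> (\<lambda>_. 0)" using k by (auto simp: psize_def)
    then show ?thesis
      using sum_count_list_eq_sum_list[of "cost W" gs] sum_count_list_eq_sum_list[of "correct W _" gs]
      by (simp add: profit_def size)
  qed
  have "lp_objective W k z - c_PL k ?lam / exp 1 =
      (1 / real CARD('n)) * (\<Sum>i\<in>UNIV. psi_lin ?lam k (\<Sum>g\<in>UNIV. real (correct W i g) * z g) - c_PL k ?lam / exp 1)
      - price W * (\<Sum>g\<in>UNIV. cost W g * z g)"
    by (simp add: lp_objective_def sum_subtractf algebra_simps)
  also have "\<dots> \<le> (1 / real CARD('n)) * (\<Sum>i\<in>UNIV. ?E (\<lambda>gs. psi ?lam k (sum_list (map (correct W i) gs))))
      - price W * (\<Sum>g\<in>UNIV. cost W g * z g)"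
    using expected_psi_ge[OF a k lam, where p = p]
    by (intro diff_right_mono mult_left_mono sum_mono) (simp_all add: Ep)
  also have "\<dots> = ?E ?pay"
    by (simp add: int expectation_sum_list_replicate_pmf Ep)
  also have "\<dots> = ?E (\<lambda>gs. profit W (count_list gs))"
    by (intro integral_cong_AE) (auto simp: AE_measure_pmf_iff profit)
  also have "\<dots> = measure_pmf.expectation (rounded k z) (profit W)"
    by (simp add: rounded_def p_def)
  finally show ?thesis .
qed

section \<open>Linear programming duality\<close>

lemma explicit_constraints_iff:
  fixes W :: "('n::finite, 'g::finite) workflow_problem"
  shows "(\<forall>c \<in> explicit_constraints W k. satisfies (\<mu>, \<xi>, \<theta>) c) \<longleftrightarrow>
    (\<forall>i. \<forall>r\<le>k. psi (strength W) k r / real CARD('n) \<le> \<xi> $ i + real r * \<mu> $ i) \<and>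
    (\<forall>i. 0 \<le> \<mu> $ i \<and> \<mu> $ i \<le> incr (strength W) 1 k / real CARD('n) \<and>
         0 \<le> \<xi> $ i \<and> \<xi> $ i \<le> 1 / real CARD('n)) \<and>
    - (price W * cost_max W) \<le> \<theta> \<and> \<theta> \<le> incr (strength W) 1 k"
proof -
  have 1: "satisfies (\<mu>, \<xi>, \<theta>) ((- (real r *\<^sub>R axis i 1), - axis i 1, 0), - t) \<longleftrightarrow> t \<le> \<xi> $ i + real r * \<mu> $ i"
    for r i t by (simp add: satisfies_def inner_axis') linarith
  have 2: "satisfies (\<mu>, \<xi>, \<theta>) ((- axis i 1, 0, 0), 0) \<longleftrightarrow> 0 \<le> \<mu> $ i"
    "satisfies (\<mu>, \<xi>, \<theta>) ((axis i 1, 0, 0), t) \<longleftrightarrow> \<mu> $ i \<le> t"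
    "satisfies (\<mu>, \<xi>, \<theta>) ((0, - axis i 1, 0), 0) \<longleftrightarrow> 0 \<le> \<xi> $ i"
    "satisfies (\<mu>, \<xi>, \<theta>) ((0, axis i 1, 0), t) \<longleftrightarrow> \<xi> $ i \<le> t" for i t
    by (simp_all add: satisfies_def inner_axis')
  have 3: "satisfies (\<mu>, \<xi>, \<theta>) ((0, 0, - 1), t) \<longleftrightarrow> - t \<le> \<theta>"
    "satisfies (\<mu>, \<xi>, \<theta>) ((0, 0, 1), t) \<longleftrightarrow> \<theta> \<le> t" for t
    by (auto simp: satisfies_def)
  have B: "(\<forall>c\<in>{f i r | i r. P r}. Q c) \<longleftrightarrow> (\<forall>i r. P r \<longrightarrow> Q (f i r))"
    "(\<forall>c\<in>{h i | i. True}. Q c) \<longleftrightarrow> (\<forall>i. Q (h i))"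
    "(\<forall>c\<in>{d, e}. Q c) \<longleftrightarrow> Q d \<and> Q e"
    for f :: "'n \<Rightarrow> nat \<Rightarrow> 'n dual halfspace" and h :: "'n \<Rightarrow> 'n dual halfspace" and P Q d e
    by blast+
  show ?thesis
    unfolding explicit_constraints_def Let_def ball_Un B 1 2 3 by blast
qed

lemma satisfies_workflow_constraint:
  "satisfies (\<mu>, \<xi>, \<theta>) (workflow_constraint W g) \<longleftrightarrow> score W \<mu> g \<le> \<theta>"
  by (auto simp: satisfies_def workflow_constraint_def score_def inner_vec_def mult.commute)

lemma dual_feasible_iff:
  "(\<mu>, \<xi>, \<theta>) \<in> dual_feasible W k M \<longleftrightarrow>
    (\<forall>c \<in> explicit_constraints W k. satisfies (\<mu>, \<xi>, \<theta>) c) \<and> (\<forall>g\<in>M. score W \<mu> g \<le> \<theta>)"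
  by (simp add: dual_feasible_def ball_Un satisfies_workflow_constraint)

text \<open>Interchanging the sums over tasks and workflows turns prices on loads into
  scores.\<close>

lemma sum_score:
  fixes W :: "('n::finite, 'g::finite) workflow_problem"
  shows "(\<Sum>i\<in>UNIV. \<mu> $ i * (\<Sum>g\<in>UNIV. real (correct W i g) * z g)) - price W * (\<Sum>g\<in>UNIV. cost W g * z g)
    = (\<Sum>g\<in>UNIV. z g * score W \<mu> g)"
proof -
  have "(\<Sum>i\<in>UNIV. \<mu> $ i * (\<Sum>g\<in>UNIV. real (correct W i g) * z g))
      = (\<Sum>g\<in>UNIV. \<Sum>i\<in>UNIV. \<mu> $ i * (real (correct W i g) * z g))"
    by (subst sum.swap) (simp add: sum_distrib_left)
  then show ?thesis
    by (simp add: score_def right_diff_distrib sum_subtractf sum_distrib_left mult_ac)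
qed

lemma correct_load_bounds:
  assumes "valid_problem W" "z \<in> lp_feasible k M"
  shows "0 \<le> (\<Sum>g\<in>UNIV. real (correct W i g) * z g)" "(\<Sum>g\<in>UNIV. real (correct W i g) * z g) \<le> real k"
proof -
  have z: "0 \<le> z g" and a: "correct W i g \<in> {0, 1}" for g
    using assms by (auto simp: lp_feasible_def valid_problem_def)
  show "0 \<le> (\<Sum>g\<in>UNIV. real (correct W i g) * z g)" using z by (intro sum_nonneg) auto
  have "real (correct W i g) * z g \<le> z g" for g using a[of g] z[of g] by auto
  then have "(\<Sum>g\<in>UNIV. real (correct W i g) * z g) \<le> (\<Sum>g\<in>UNIV. z g)" by (rule sum_mono)
  then show "(\<Sum>g\<in>UNIV. real (correct W i g) * z g) \<le> real k"
    using assms(2) by (simp add: lp_feasible_def)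
qed

text \<open>The slack \<open>tau\<close> is absorbed by raising \<theta>, and the mass
  \<open>k\<close> of \<open>z\<close> turns it into \<open>k * tau\<close>.\<close>

lemma weak_duality:
  fixes W :: "('n::finite, 'g::finite) workflow_problem"
  assumes W: "valid_problem W"
    and expl: "\<forall>c \<in> explicit_constraints W k. satisfies (\<mu>, \<xi>, \<theta>) c"
    and sc: "\<And>g. g \<in> M \<Longrightarrow> score W \<mu> g \<le> \<theta> + tau"
    and z: "z \<in> lp_feasible k M"
  shows "lp_objective W k z \<le> dual_objective k (\<mu>, \<xi>, \<theta>) + real k * tau"
proof -
  let ?u = "\<lambda>i. \<Sum>g\<in>UNIV. real (correct W i g) * z g"
  \<comment> \<open>The explicit constraints hold at integers; interpolation extends them to the
    fractional load.\<close>
  have task: "psi_lin (strength W) k (?u i) / real CARD('n) \<le> \<xi> $ i + \<mu> $ i * ?u i" for i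
  proof -
    have con: "psi (strength W) k r / real CARD('n) \<le> \<xi> $ i + \<mu> $ i * real r" if "r \<le> k" for r
      using expl that unfolding explicit_constraints_iff by (simp add: mult.commute)
    obtain r s e f where *: "r \<le> k" "s \<le> k" "0 \<le> e" "0 \<le> f" "e + f = 1" "?u i = e * real r + f * real s"
      "psi_lin (strength W) k (?u i) = e * psi (strength W) k r + f * psi (strength W) k s"
      by (rule psi_lin_between[OF correct_load_bounds[OF W z, of i] order_refl])
    have "psi_lin (strength W) k (?u i) / real CARD('n)
        = e * (psi (strength W) k r / real CARD('n)) + f * (psi (strength W) k s / real CARD('n))"
      by (simp add: *(7) add_divide_distrib)
    also have "\<dots> \<le> e * (\<xi> $ i + \<mu> $ i * real r) + f * (\<xi> $ i + \<mu> $ i * real s)"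
      using * by (intro add_mono mult_left_mono con) auto
    also have "\<dots> = (e + f) * \<xi> $ i + \<mu> $ i * (e * real r + f * real s)" by algebra
    finally show ?thesis by (simp add: * (5,6))
  qed
  have zs: "z g * score W \<mu> g \<le> z g * (\<theta> + tau)" for g
  proof (cases "g \<in> M")
    case True
    then show ?thesis using sc z by (intro mult_left_mono) (auto simp: lp_feasible_def)
  qed (use z in \<open>auto simp: lp_feasible_def\<close>)
  have "lp_objective W k z = (\<Sum>i\<in>UNIV. psi_lin (strength W) k (?u i) / real CARD('n))
      - price W * (\<Sum>g\<in>UNIV. cost W g * z g)"
    by (simp add: lp_objective_def sum_divide_distrib)
  also have "\<dots> \<le> (\<Sum>i\<in>UNIV. \<xi> $ i + \<mu> $ i * ?u i) - price W * (\<Sum>g\<in>UNIV. cost W g * z g)"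
    by (intro diff_right_mono sum_mono task)
  also have "\<dots> = (\<Sum>i\<in>UNIV. \<xi> $ i) + (\<Sum>g\<in>UNIV. z g * score W \<mu> g)"
    using sum_score[of \<mu> W z] by (simp add: sum.distrib)
  also have "\<dots> \<le> (\<Sum>i\<in>UNIV. \<xi> $ i) + (\<Sum>g\<in>UNIV. z g * (\<theta> + tau))"
    by (intro add_left_mono sum_mono zs)
  also have "(\<Sum>g\<in>UNIV. z g * (\<theta> + tau)) = real k * (\<theta> + tau)"
    using z by (simp add: lp_feasible_def flip: sum_distrib_right)
  finally show ?thesis by (simp add: dual_objective_def algebra_simps)
qed

section \<open>Strong duality by separation of convex sets\<close>

lemma lp_feasible_combination:
  assumes "y \<in> lp_feasible k M" "z \<in> lp_feasible k M" "0 \<le> e" "0 \<le> f" "e + f = 1"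
  shows "(\<lambda>g. e * y g + f * z g) \<in> lp_feasible k M"
proof -
  have "(\<Sum>g\<in>UNIV. e * y g + f * z g) = (e + f) * real k"
    using assms(1,2) by (simp add: lp_feasible_def sum.distrib distrib_right flip: sum_distrib_left)
  then show ?thesis using assms by (simp add: lp_feasible_def)
qed

text \<open>In the space of task loads \<open>u\<close> and payoffs \<open>t\<close>, the set of achievable pairs (load, minus
  cost) is disjoint from the convex set where \<open>t\<close> plus the reward of \<open>u\<close> exceeds \<open>L\<close>. The normal
  of a separating hyperplane gives the task prices.\<close>

lemma lp_separation:
  fixes W :: "('n::finite, 'g::finite) workflow_problem"
  assumes W: "valid_problem W" and k: "1 \<le> k" and M: "M \<noteq> {}"
    and L: "\<And>z. z \<in> lp_feasible k M \<Longrightarrow> lp_objective W k z \<le> L"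
  obtains \<mu> :: "real ^ 'n" and \<beta> where
    "\<And>u. (\<Sum>i\<in>UNIV. psi_lin (strength W) k (u $ i)) / real CARD('n) - \<mu> \<bullet> u \<le> L - \<beta>"
    "\<And>z. z \<in> lp_feasible k M \<Longrightarrow> (\<Sum>g\<in>UNIV. z g * score W \<mu> g) \<le> \<beta>"
proof -
  have lam: "1 \<le> strength W" using W by (simp add: valid_problem_def)
  define load :: "('g \<Rightarrow> real) \<Rightarrow> real ^ 'n" where
    "load z = (\<chi> i. \<Sum>g\<in>UNIV. real (correct W i g) * z g)" for z
  define neg_cost where "neg_cost z = - (price W * (\<Sum>g\<in>UNIV. cost W g * z g))" for z
  define reward where "reward u = (\<Sum>i\<in>UNIV. psi_lin (strength W) k (u $ i)) / real CARD('n)" for u :: "real ^ 'n"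
  define C1 where "C1 = (\<lambda>z. (load z, neg_cost z)) ` lp_feasible k M"
  define C2 where "C2 = {(u, t). L - reward u < t}"
  have obj: "lp_objective W k z = reward (load z) + neg_cost z" for z
    by (simp add: lp_objective_def reward_def load_def neg_cost_def)
  have reward0: "reward 0 = 0" by (simp add: reward_def psi_lin_nonpos[OF k])
  obtain g0 where g0: "g0 \<in> M" using M by auto
  have "(\<lambda>g. if g = g0 then real k else 0) \<in> lp_feasible k M"
    using g0 by (auto simp: lp_feasible_def)
  then have "C1 \<noteq> {}" by (auto simp: C1_def)
  have "(0, L + 1) \<in> C2" by (simp add: C2_def reward0)
  then have "C2 \<noteq> {}" by auto
  have "C1 \<inter> C2 = {}" using L by (fastforce simp: C1_def C2_def obj)
  have "convex C1"
  proof (rule convexI)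
    fix x y and e f :: real
    assume *: "x \<in> C1" "y \<in> C1" "0 \<le> e" "0 \<le> f" "e + f = 1"
    then obtain v w where vw: "v \<in> lp_feasible k M" "w \<in> lp_feasible k M"
      "x = (load v, neg_cost v)" "y = (load w, neg_cost w)" by (auto simp: C1_def)
    let ?c = "\<lambda>g. e * v g + f * w g"
    have "e *\<^sub>R x + f *\<^sub>R y = (load ?c, neg_cost ?c)"
      by (simp add: vw load_def neg_cost_def vec_eq_iff sum.distrib sum_distrib_left algebra_simps)
    then show "e *\<^sub>R x + f *\<^sub>R y \<in> C1"
      using lp_feasible_combination[OF vw(1,2) *(3-5)] by (auto simp: C1_def)
  qed
  have reward_concave: "e * reward u + f * reward v \<le> reward (e *\<^sub>R u + f *\<^sub>R v)"
    if "0 \<le> e" "0 \<le> f" "e + f = 1" for e f u v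
    using psi_lin_concave[OF lam k that]
    by (simp add: reward_def sum_distrib_left divide_right_mono sum_mono
        flip: sum.distrib add_divide_distrib)
  have "convex C2"
  proof (rule convexI)
    fix x y and e f :: real
    assume *: "x \<in> C2" "y \<in> C2" "0 \<le> e" "0 \<le> f" "e + f = 1"
    obtain u s v t where xy: "x = (u, s)" "y = (v, t)" by (cases x, cases y)
    have "e * (L - reward u) + f * (L - reward v) < e * s + f * t"
    proof (cases "e = 0")
      case True
      then show ?thesis using * by (simp add: C2_def xy)
    next
      case False
      then show ?thesis
        using * by (intro add_less_le_mono mult_strict_left_mono mult_left_mono) (auto simp: C2_def xy)
    qed
    moreover have "e * (L - reward u) + f * (L - reward v) = (e + f) * L - (e * reward u + f * reward v)"
      by algebra
    ultimately show "e *\<^sub>R x + f *\<^sub>R y \<in> C2"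
      using reward_concave[OF *(3-5), of u v] *(5) by (simp add: C2_def xy)
  qed
  obtain ab \<beta> where ab: "ab \<noteq> 0" "\<forall>x\<in>C1. ab \<bullet> x \<le> \<beta>" "\<forall>x\<in>C2. \<beta> \<le> ab \<bullet> x"
    using separating_hyperplane_sets[OF \<open>convex C1\<close> \<open>convex C2\<close> \<open>C1 \<noteq> {}\<close> \<open>C2 \<noteq> {}\<close> \<open>C1 \<inter> C2 = {}\<close>] by blast
  obtain a b where "ab = (a, b)" by (cases ab)
  note ab = ab[unfolded this]
  have above: "\<beta> \<le> a \<bullet> u + b * t" if "L - reward u < t" for u t
    using ab(3) that by (force simp: C2_def)
  \<comment> \<open>\<open>C2\<close> contains arbitrarily large \<open>t\<close> over
    \<open>u = 0\<close>; for negative \<open>b\<close> the chosen \<open>t\<close> would push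
    \<open>b * t\<close> to at most \<beta> - 1.\<close>
  have "0 \<le> b"
  proof (rule ccontr)
    assume "\<not> 0 \<le> b"
    define t where "t = max (L + 1) ((\<beta> - 1) / b)"
    have "b * t \<le> b * ((\<beta> - 1) / b)" using \<open>\<not> 0 \<le> b\<close> by (intro mult_left_mono_neg) (auto simp: t_def)
    moreover have "\<beta> \<le> b * t" using above[of 0 t] by (simp add: reward0 t_def)
    ultimately show False using \<open>\<not> 0 \<le> b\<close> by simp
  qed
  \<comment> \<open>\<open>C2\<close> has points over every \<open>u\<close>, so a vertical
    hyperplane would bound \<open>a \<bullet> u\<close> from below on the whole space; the witness
    gives it the value \<beta> - 1.\<close>
  moreover have "b \<noteq> 0"
  proof
    assume "b = 0"
    then have "a \<noteq> 0" using ab(1) by (auto simp: zero_prod_def)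
    let ?u = "((\<beta> - 1) / (a \<bullet> a)) *\<^sub>R a"
    have "\<beta> \<le> a \<bullet> ?u" using above[of ?u "L - reward ?u + 1"] \<open>b = 0\<close> by simp
    then show False using \<open>a \<noteq> 0\<close> by simp
  qed
  ultimately have b: "0 < b" by simp
  define \<mu> where "\<mu> = a /\<^sub>R b"
  \<comment> \<open>Membership in \<open>C2\<close> is strict, so its boundary is approached through
    positive \<open>e\<close>.\<close>
  have 1: "reward u - \<mu> \<bullet> u \<le> L - \<beta> / b" for u
  proof (rule field_le_epsilon)
    fix e :: real assume "0 < e"
    then have "\<beta> \<le> a \<bullet> u + b * (L - reward u + e)" by (intro above) auto
    then have "\<beta> / b \<le> (a \<bullet> u + b * (L - reward u + e)) / b" using b by (intro divide_right_mono) auto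
    also have "\<dots> = \<mu> \<bullet> u + (L - reward u + e)"
      using b by (simp add: \<mu>_def add_divide_distrib divide_inverse_commute[of "a \<bullet> u"])
    finally show "reward u - \<mu> \<bullet> u \<le> L - \<beta> / b + e" by simp
  qed
  have 2: "(\<Sum>g\<in>UNIV. z g * score W \<mu> g) \<le> \<beta> / b" if "z \<in> lp_feasible k M" for z
  proof -
    have "a \<bullet> load z + b * neg_cost z \<le> \<beta>" using ab(2) that by (auto simp: C1_def)
    then have "(a \<bullet> load z + b * neg_cost z) / b \<le> \<beta> / b" using b by (intro divide_right_mono) auto
    then have "\<mu> \<bullet> load z + neg_cost z \<le> \<beta> / b"
      using b by (simp add: \<mu>_def add_divide_distrib divide_inverse_commute[of "a \<bullet> load z"])
    then show ?thesis
      using sum_score[of \<mu> W z] by (simp add: inner_vec_def load_def neg_cost_def)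
  qed
  show ?thesis using that[OF 1[unfolded reward_def] 2] .
qed

text \<open>The separation inequality holds for all real \<open>u\<close>, also outside the range of
  loads, and this forces the prices into the explicit bounds. With the best integer gains as \<xi>
  and the best score as \<theta>, the two separation bounds L - \<beta> and \<beta> add up to
  \<open>L\<close>.\<close>

lemma strong_duality:
  fixes W :: "('n::finite, 'g::finite) workflow_problem"
  assumes W: "valid_problem W" and k: "1 \<le> k" and M: "M \<noteq> {}"
    and L: "\<And>z. z \<in> lp_feasible k M \<Longrightarrow> lp_objective W k z \<le> L"
  obtains y where "y \<in> dual_feasible W k M" "dual_objective k y \<le> L"
proof -
  let ?lam = "strength W" and ?n = "real CARD('n)"
  have lam: "1 \<le> ?lam" and a: "\<And>i g. correct W i g \<in> {0, 1}" and price: "0 \<le> price W"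
    and cost: "\<And>g. 0 \<le> cost W g" "\<And>g. cost W g \<le> cost_max W"
    using W by (auto simp: valid_problem_def)
  obtain \<mu> :: "real ^ 'n" and \<beta> where
    gap: "\<And>u. (\<Sum>i\<in>UNIV. psi_lin ?lam k (u $ i)) / ?n - \<mu> \<bullet> u \<le> L - \<beta>" and
    sc: "\<And>z. z \<in> lp_feasible k M \<Longrightarrow> (\<Sum>g\<in>UNIV. z g * score W \<mu> g) \<le> \<beta>"
    using lp_separation[OF W k M L] by blast
  have psi0: "psi_lin ?lam k 0 = 0" by (simp add: psi_lin_nonpos[OF k])
  have "0 \<le> L - \<beta>" using gap[of 0] by (simp add: psi0)
  have one: "psi_lin ?lam k s / ?n - \<mu> $ i * s \<le> L - \<beta>" for i s
  proof -
    have "(\<Sum>j\<in>UNIV. psi_lin ?lam k ((s *\<^sub>R axis i 1 :: real ^ 'n) $ j))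
        = (\<Sum>j\<in>UNIV. if j = i then psi_lin ?lam k s else 0)"
      by (intro sum.cong) (auto simp: axis_def psi0)
    then show ?thesis using gap[of "s *\<^sub>R axis i 1"] by (simp add: inner_axis mult.commute)
  qed
  have \<mu>_le: "\<mu> $ i \<le> incr ?lam 1 k / ?n" for i
  proof (rule ccontr)
    assume *: "\<not> ?thesis"
    define c where "c = incr ?lam 1 k / ?n - \<mu> $ i"
    then have "c < 0" using * by simp
    \<comment> \<open>Nonpositive, where the slope is the first increment; chosen so that
      \<open>c * s\<close> exceeds the bound of \<open>one\<close> by 1.\<close>
    define s where "s = (L - \<beta> + 1) / c"
    have "s \<le> 0" unfolding s_def using \<open>c < 0\<close> \<open>0 \<le> L - \<beta>\<close> by (intro divide_nonneg_neg) auto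
    then have "psi_lin ?lam k s / ?n - \<mu> $ i * s = c * s"
      by (simp add: psi_lin_nonpos[OF k] c_def left_diff_distrib)
    then have "c * s \<le> L - \<beta>" using one[of s i] by simp
    then show False using \<open>c < 0\<close> by (simp add: s_def)
  qed
  have \<mu>_ge: "0 \<le> \<mu> $ i" for i
  proof (rule ccontr)
    assume *: "\<not> ?thesis"
    \<comment> \<open>From \<open>k\<close> on the curve is nonnegative, so a negative price times a
      large \<open>s\<close> breaks the bound of \<open>one\<close>.\<close>
    define s where "s = max (real k) ((L - \<beta> + 1) / - \<mu> $ i)"
    have "0 \<le> psi_lin ?lam k s"
      using psi_lin_beyond[OF k, of s ?lam] incr_nonneg[OF lam k, of k] psi_full[OF lam k] by (simp add: s_def)
    then have "0 \<le> psi_lin ?lam k s / ?n" by simp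
    with one[of s i] have "- \<mu> $ i * s \<le> L - \<beta>" by simp
    moreover have "- \<mu> $ i * ((L - \<beta> + 1) / - \<mu> $ i) \<le> - \<mu> $ i * s"
      using * by (intro mult_left_mono) (auto simp: s_def)
    ultimately show False using * by simp
  qed
  define gain where "gain i r = psi ?lam k r / ?n - real r * \<mu> $ i" for i r
  define \<xi> :: "real ^ 'n" where "\<xi> = (\<chi> i. Max (gain i ` {..k}))"
  have gain_le: "gain i r \<le> \<xi> $ i" if "r \<le> k" for i r
    using that by (auto simp: \<xi>_def)
  have "\<exists>r\<le>k. \<xi> $ i = gain i r" for i
    using Max_in[of "gain i ` {..k}"] by (simp add: \<xi>_def image_iff Bex_def)
  then obtain r where r: "\<And>i. r i \<le> k" "\<And>i. \<xi> $ i = gain i (r i)" by metis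
  \<comment> \<open>The maximizers of all tasks form a single vector \<open>u\<close>, so one
    instance of \<open>gap\<close> bounds the sum of the maxima.\<close>
  have "(\<Sum>i\<in>UNIV. \<xi> $ i) = (\<Sum>i\<in>UNIV. psi_lin ?lam k ((\<chi> i. real (r i)) $ i)) / ?n - \<mu> \<bullet> (\<chi> i. real (r i))"
    by (simp add: r gain_def psi_lin_of_nat inner_vec_def sum_subtractf sum_divide_distrib mult.commute)
  also have "\<dots> \<le> L - \<beta>" by (rule gap)
  finally have \<xi>_sum: "(\<Sum>i\<in>UNIV. \<xi> $ i) \<le> L - \<beta>" .
  define \<theta> where "\<theta> = Max (score W \<mu> ` M)"
  have \<theta>: "score W \<mu> g \<le> \<theta>" if "g \<in> M" for g using that by (auto simp: \<theta>_def)
  have "\<theta> \<in> score W \<mu> ` M" unfolding \<theta>_def using M by (intro Max_in) auto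
  then obtain g where g: "g \<in> M" "\<theta> = score W \<mu> g" by auto
  \<comment> \<open>All mass \<open>k\<close> on a workflow with the best score in
    \<open>M\<close>.\<close>
  have "(\<Sum>h\<in>UNIV. (if h = g then real k else 0) * score W \<mu> h) \<le> \<beta>"
    using g by (intro sc) (auto simp: lp_feasible_def)
  also have "(\<Sum>h\<in>UNIV. (if h = g then real k else 0) * score W \<mu> h)
      = (\<Sum>h\<in>UNIV. if h = g then real k * score W \<mu> h else 0)"
    by (intro sum.cong) auto
  finally have k\<theta>: "real k * \<theta> \<le> \<beta>" by (simp add: g)
  have "0 \<le> (\<Sum>i\<in>UNIV. \<mu> $ i * real (correct W i g))" using \<mu>_ge by (intro sum_nonneg) auto
  moreover have "price W * cost W g \<le> price W * cost_max W" using price cost by (intro mult_left_mono)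
  ultimately have \<theta>_ge: "- (price W * cost_max W) \<le> \<theta>" by (simp add: g score_def)
  have "\<mu> $ i * real (correct W i g) \<le> incr ?lam 1 k / ?n" for i
    using a[of i g] \<mu>_le[of i] \<mu>_ge[of i] by auto
  then have "(\<Sum>i\<in>UNIV. \<mu> $ i * real (correct W i g)) \<le> (\<Sum>i\<in>(UNIV::'n set). incr ?lam 1 k / ?n)"
    by (rule sum_mono)
  moreover have "0 \<le> price W * cost W g" using price cost by simp
  ultimately have \<theta>_le: "\<theta> \<le> incr ?lam 1 k" by (simp add: g score_def)
  have "psi ?lam k r / ?n \<le> \<xi> $ i + real r * \<mu> $ i" if "r \<le> k" for i r
    using gain_le[OF that, of i] by (simp add: gain_def)
  moreover have "0 \<le> \<xi> $ i" for i using gain_le[of 0 i] by (simp add: gain_def)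
  moreover have "\<xi> $ i \<le> 1 / ?n" for i
  proof -
    have "psi ?lam k (r i) / ?n \<le> 1 / ?n" by (intro divide_right_mono psi_le_1 lam k r) auto
    moreover have "0 \<le> real (r i) * \<mu> $ i" using \<mu>_ge by simp
    ultimately show ?thesis unfolding r gain_def by linarith
  qed
  ultimately have "(\<mu>, \<xi>, \<theta>) \<in> dual_feasible W k M"
    unfolding dual_feasible_iff explicit_constraints_iff using \<mu>_le \<mu>_ge \<theta>_ge \<theta>_le \<theta> by auto
  moreover have "dual_objective k (\<mu>, \<xi>, \<theta>) \<le> L"
    using \<xi>_sum k\<theta> by (simp add: dual_objective_def)
  ultimately show ?thesis by (rule that)
qed

section \<open>Primal recovery and comparison with the optimal portfolio\<close>

lemma is_arg_max_arg_max: "is_arg_max f P x \<Longrightarrow> is_arg_max f P (arg_max f P)"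
  unfolding arg_max_def by (rule someI[where P = "is_arg_max f P"])

text \<open>\<open>arg_max\<close> is informative only once a maximum exists. It does: transported
  to vectors in \<open>real ^ 'g\<close>, the feasible points form a compact set and the objective
  is continuous.\<close>

lemma recovered_optimal:
  fixes W :: "('n::finite, 'g::finite) workflow_problem"
  assumes M: "M \<noteq> {}"
  shows "recovered W k M \<in> lp_feasible k M"
    and "z \<in> lp_feasible k M \<Longrightarrow> lp_objective W k z \<le> lp_objective W k (recovered W k M)"
proof -
  define S where "S = {v :: real ^ 'g. ($) v \<in> lp_feasible k M}"
  have "S = (\<Inter>g. {v. 0 \<le> v $ g}) \<inter> {v. (\<Sum>g\<in>UNIV. v $ g) = real k} \<inter> (\<Inter>g\<in>-M. {v. v $ g = 0})"
    by (auto simp: S_def lp_feasible_def)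
  also have "closed \<dots>"
    by (intro closed_Int closed_INT ballI closed_Collect_le closed_Collect_eq continuous_intros)
  finally have "closed S" .
  moreover have "norm v \<le> real k" if "v \<in> S" for v
    using norm_le_l1_cart[of v] that by (auto simp: S_def lp_feasible_def)
  then have "bounded S" by (auto simp: bounded_iff)
  ultimately have "compact S" by (simp add: compact_eq_bounded_closed)
  obtain g0 where "g0 \<in> M" using M by auto
  then have "(\<chi> g. if g = g0 then real k else 0) \<in> S" by (auto simp: S_def lp_feasible_def)
  then have "S \<noteq> {}" by auto
  have "continuous_on S (\<lambda>v. lp_objective W k (($) v))"
    unfolding lp_objective_def psi_lin_def by (intro continuous_intros)
  then obtain v where v: "v \<in> S" "\<And>u. u \<in> S \<Longrightarrow> lp_objective W k (($) u) \<le> lp_objective W k (($) v)"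
    using continuous_attains_sup[OF \<open>compact S\<close> \<open>S \<noteq> {}\<close>] by blast
  have max: "lp_objective W k y \<le> lp_objective W k (($) v)" if "y \<in> lp_feasible k M" for y
  proof -
    have "($) (vec_lambda y) = y" by (simp add: fun_eq_iff)
    then show ?thesis using v(2)[of "vec_lambda y"] that by (simp add: S_def)
  qed
  have "is_arg_max (lp_objective W k) (\<lambda>z. z \<in> lp_feasible k M) (($) v)"
    using v(1) max by (auto simp: is_arg_max_linorder S_def)
  then have "is_arg_max (lp_objective W k) (\<lambda>z. z \<in> lp_feasible k M) (recovered W k M)"
    unfolding recovered_def by (rule is_arg_max_arg_max)
  then show "recovered W k M \<in> lp_feasible k M"
    and "z \<in> lp_feasible k M \<Longrightarrow> lp_objective W k z \<le> lp_objective W k (recovered W k M)"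
    by (auto simp: is_arg_max_linorder)
qed

text \<open>The dual value of \<open>x\<close> lies between two primal values: weak duality puts
  every \<open>z\<close> of the full relaxation below it, and the dual point \<open>y\<close>
  obtained for \<open>M\<close> puts it below the recovered value, up to half of \<open>eps\<close>
  each.\<close>

lemma recovered_near_optimal:
  fixes W :: "('n::finite, 'g::finite) workflow_problem"
  assumes W: "valid_problem W" and k: "1 \<le> k" and M: "M \<noteq> {}"
    and expl: "\<forall>c \<in> explicit_constraints W k. satisfies x c"
    and sc: "\<And>g. score W (fst x) g \<le> snd (snd x) + eps / (2 * real k)"
    and opt: "\<And>y. y \<in> dual_feasible W k M \<Longrightarrow> dual_objective k x \<le> dual_objective k y + eps / 2"
    and z: "z \<in> lp_feasible k UNIV"
  shows "lp_objective W k z - eps \<le> lp_objective W k (recovered W k M)"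
proof -
  obtain y where y: "y \<in> dual_feasible W k M" "dual_objective k y \<le> lp_objective W k (recovered W k M)"
    using strong_duality[OF W k M recovered_optimal(2)[OF M]] by blast
  obtain \<mu> \<xi> \<theta> where x: "x = (\<mu>, \<xi>, \<theta>)" by (cases x)
  have "lp_objective W k z \<le> dual_objective k x + real k * (eps / (2 * real k))"
    using expl sc z unfolding x by (intro weak_duality[OF W]) auto
  then show ?thesis using opt[OF y(1)] y(2) k by simp
qed

text \<open>The witness is \<open>m\<close> scaled to total mass \<open>b\<close>. Cost scales
  exactly, so only the task rewards are compared, through \<open>psi_lin_scaled\<close>.\<close>

lemma profit_scaled_le_lp:
  fixes W :: "('n::finite, 'g::finite) workflow_problem"
  assumes W: "valid_problem W" and b: "1 \<le> b" "b \<le> psize m"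
  obtains z where "z \<in> lp_feasible b UNIV" "real b / real (psize m) * profit W m \<le> lp_objective W b z"
proof
  let ?c = "real b / real (psize m)"
  let ?z = "\<lambda>g. ?c * real (m g)"
  have lam: "1 \<le> strength W" and a: "\<And>i g. correct W i g \<in> {0, 1}"
    using W by (auto simp: valid_problem_def)
  have "(\<Sum>g\<in>UNIV. ?z g) = ?c * real (psize m)"
    by (simp only: psize_def of_nat_sum sum_distrib_left)
  then show "?z \<in> lp_feasible b UNIV"
    using b by (simp add: lp_feasible_def)
  have "m \<noteq> (\<lambda>_. 0)" using b by (auto simp: psize_def)
  let ?r = "\<lambda>i. \<Sum>g\<in>UNIV. correct W i g * m g"
  have "correct W i g * m g \<le> m g" for i g using a[of i g] by auto
  then have r: "?r i \<le> psize m" for i unfolding psize_def by (intro sum_mono)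
  have load: "(\<Sum>g\<in>UNIV. real (correct W i g) * ?z g) = ?c * real (?r i)" for i
    by (simp add: sum_distrib_left mult_ac)
  have "?c * profit W m = (1 / real CARD('n)) * (\<Sum>i\<in>UNIV. ?c * psi (strength W) (psize m) (?r i))
      - price W * (\<Sum>g\<in>UNIV. cost W g * ?z g)"
    using \<open>m \<noteq> (\<lambda>_. 0)\<close> by (simp add: profit_def right_diff_distrib sum_distrib_left mult_ac)
  also have "\<dots> \<le> (1 / real CARD('n)) * (\<Sum>i\<in>UNIV. psi_lin (strength W) b (?c * real (?r i)))
      - price W * (\<Sum>g\<in>UNIV. cost W g * ?z g)"
    by (intro diff_right_mono mult_left_mono sum_mono psi_lin_scaled lam b r) auto
  also have "\<dots> = lp_objective W b ?z" unfolding lp_objective_def load ..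
  finally show "?c * profit W m \<le> lp_objective W b ?z" .
qed

section \<open>Success probability of the pricing phase\<close>

lemma is_arg_max_arg_max_finite:
  fixes f :: "'a \<Rightarrow> 'b::linorder"
  assumes "finite S" "S \<noteq> {}"
  shows "is_arg_max f (\<lambda>x. x \<in> S) (arg_max f (\<lambda>x. x \<in> S))"
proof -
  have "Max (f ` S) \<in> f ` S" using assms by simp
  then obtain x where "x \<in> S" "Max (f ` S) = f x" by auto
  then have "is_arg_max f (\<lambda>x. x \<in> S) x"
    using assms Max_ge[of "f ` S"] by (auto simp: is_arg_max_linorder)
  then show ?thesis by (rule is_arg_max_arg_max)
qed

text \<open>Total probability in the shape used by the failure estimates: \<open>d = 0\<close>
  multiplies probabilities, \<open>c = 1\<close> adds them.\<close>

lemma prob_bind_pmf_le: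
  assumes "\<And>x. x \<in> set_pmf p \<Longrightarrow> measure_pmf.prob (f x) B \<le> c * indicator A x + d" "0 \<le> c" "0 \<le> d"
  shows "measure_pmf.prob (bind_pmf p f) B \<le> c * measure_pmf.prob p A + d"
proof -
  have ind: "integrable p (indicator A :: _ \<Rightarrow> real)"
    by (rule measure_pmf.integrable_const_bound[where B = 1]) auto
  then have int: "integrable p (\<lambda>x. c * indicator A x + d :: real)"
    by (intro Bochner_Integration.integrable_add integrable_mult_right) auto
  have "ennreal (measure_pmf.prob (bind_pmf p f) B) = (\<integral>\<^sup>+x. ennreal (measure_pmf.prob (f x) B) \<partial>p)"
    by (simp flip: measure_pmf.emeasure_eq_measure)
  also have "\<dots> \<le> (\<integral>\<^sup>+x. ennreal (c * indicator A x + d) \<partial>p)"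
    using assms by (intro nn_integral_mono_AE) (simp add: AE_measure_pmf_iff ennreal_leI del: ennreal_plus)
  also have "\<dots> = ennreal (\<integral>x. c * indicator A x + d \<partial>p)"
    using assms by (intro nn_integral_eq_integral int) auto
  also have "(\<integral>x. c * indicator A x + d \<partial>p) = c * measure_pmf.prob p A + d"
    using ind by (subst Bochner_Integration.integral_add) auto
  finally show ?thesis using assms by (simp add: ennreal_le_iff del: ennreal_plus)
qed

lemma length_batch_calls: "(gs, hist') \<in> set_pmf (batch_calls orc \<mu> \<delta> j hist) \<Longrightarrow> length gs = j"
  by (induction j arbitrary: gs hist) fastforce+

text \<open>The guarantee holds for every history, so the induction runs over arbitrary
  \<open>hist\<close> and multiplies conditional failure probabilities, although the calls may
  depend on each other.\<close>

lemma prob_batch_calls_fail: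
  fixes W :: "('n::finite, 'g::finite) workflow_problem"
  assumes orc: "pricing_guarantee W orc q" and \<mu>: "\<And>i. 0 \<le> \<mu> $ i" and \<delta>: "0 < \<delta>"
  shows "measure_pmf.prob (batch_calls orc \<mu> \<delta> j hist)
      {(gs, hist'). \<forall>g\<in>set gs. score W \<mu> g < best_score W \<mu> - \<delta>} \<le> (1 - q) ^ j"
proof (induction j arbitrary: hist)
  case (Suc j)
  let ?bad = "{g. score W \<mu> g < best_score W \<mu> - \<delta>}"
  let ?B = "{(gs, hist' :: ('n, 'g) history). \<forall>g\<in>set gs. score W \<mu> g < best_score W \<mu> - \<delta>}"
  have good: "q \<le> measure_pmf.prob (orc hist \<mu> \<delta>) {g. score W \<mu> g \<ge> best_score W \<mu> - \<delta>}"
    using orc \<mu> \<delta> by (simp add: pricing_guarantee_def)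
  also have "\<dots> \<le> 1" by simp
  finally have "q \<le> 1" .
  have "?bad = UNIV - {g. score W \<mu> g \<ge> best_score W \<mu> - \<delta>}" by auto
  then have bad: "measure_pmf.prob (orc hist \<mu> \<delta>) ?bad \<le> 1 - q"
    using good measure_pmf.prob_compl[of "{g. score W \<mu> g \<ge> best_score W \<mu> - \<delta>}" "orc hist \<mu> \<delta>"] by simp
  define f where "f = (\<lambda>g. map_pmf (\<lambda>(gs, hist'). (g # gs, hist')) (batch_calls orc \<mu> \<delta> j (hist @ [(\<mu>, \<delta>, g)])))"
  have "measure_pmf.prob (f g) ?B \<le> (1 - q) ^ j * indicator ?bad g + 0" for g
  proof (cases "g \<in> ?bad")
    case True
    then have "(\<lambda>(gs, hist'). (g # gs, hist')) -` ?B = ?B" by auto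
    then show ?thesis using Suc.IH True by (simp only: f_def measure_map_pmf) simp
  next
    case False
    then have "(\<lambda>(gs, hist'). (g # gs, hist')) -` ?B = {}" by auto
    then show ?thesis using False by (simp only: f_def measure_map_pmf) simp
  qed
  then have "measure_pmf.prob (bind_pmf (orc hist \<mu> \<delta>) f) ?B
      \<le> (1 - q) ^ j * measure_pmf.prob (orc hist \<mu> \<delta>) ?bad + 0"
    using \<open>q \<le> 1\<close> by (intro prob_bind_pmf_le) auto
  also have "\<dots> \<le> (1 - q) ^ j * (1 - q) + 0" using \<open>q \<le> 1\<close> bad by (intro add_right_mono mult_left_mono) auto
  finally show ?case by (simp add: f_def map_pmf_def case_prod_unfold mult.commute)
qed simp

definition batches_ok :: "('n::finite, 'g::finite) workflow_problem \<Rightarrow> real \<Rightarrow> ((real ^ 'n) \<times> 'g) list \<Rightarrow> bool" where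
  "batches_ok W \<delta> bs \<longleftrightarrow> (\<forall>(\<mu>, g) \<in> set bs. score W \<mu> g \<ge> best_score W \<mu> - \<delta>)"

lemma all_batches_ok_iff: "all_batches_ok W eps K R \<longleftrightarrow> (\<forall>k\<in>K. batches_ok W (eps / (2 * real k)) (R k))"
  by (simp add: all_batches_ok_def batches_ok_def)

text \<open>Only the branch without a violated explicit constraint adds a batch. The retained
  workflow has the best score of its batch, so the batch fails only if all \<open>m\<close> calls
  fail.\<close>

lemma prob_ellipsoid_step_fail:
  fixes W :: "('n::finite, 'g::finite) workflow_problem"
  assumes orc: "pricing_guarantee W orc q" and eps: "0 < eps" and k: "1 \<le> k" and m: "1 \<le> m"
    and bs: "batches_ok W (eps / (2 * real k)) bs"
  shows "measure_pmf.prob (ellipsoid_step W orc m eps p stop k (h, bs, hist))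
      {(h, bs, hist). \<not> batches_ok W (eps / (2 * real k)) bs} \<le> exp (- q * real m)"
proof -
  let ?B = "{(h :: 'n dual answer list, bs, hist :: ('n, 'g) history). \<not> batches_ok W (eps / (2 * real k)) bs}"
  define x where "x = iterate W p k h"
  define viol where "viol = {c \<in> explicit_constraints W k. \<not> satisfies x c}"
  have step: "ellipsoid_step W orc m eps p stop k (h, bs, hist) =
      (if stop h then return_pmf (h, bs, hist)
       else if viol \<noteq> {} then return_pmf (h @ [Hyperplane (SOME c. c \<in> viol)], bs, hist)
       else bind_pmf (batch_calls orc (fst x) (eps / (2 * real k)) m hist) (\<lambda>(gs, hist').
         let g = arg_max (score W (fst x)) (\<lambda>g. g \<in> set gs) in return_pmf
           (h @ [if score W (fst x) g > snd (snd x) then Hyperplane (workflow_constraint W g) else Weak_Certificate],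
            bs @ [(fst x, g)], hist')))"
    by (simp only: ellipsoid_step_def Let_def prod.case x_def viol_def)
  have return: "measure_pmf.prob (return_pmf (h', bs, hist')) ?B \<le> exp (- q * real m)" for h' hist'
    using bs by (simp add: measure_return_pmf)
  consider "stop h" | "\<not> stop h" "viol \<noteq> {}" | "\<not> stop h" "viol = {}" by blast
  then show ?thesis
  proof cases
    case 3
    let ?\<mu> = "fst x" and ?\<delta> = "eps / (2 * real k)"
    have "\<forall>c\<in>explicit_constraints W k. satisfies x c" using 3 by (auto simp: viol_def)
    \<comment> \<open>The explicit constraints include nonnegative prices, the range in which the
      pricing guarantee applies.\<close>
    then have \<mu>: "0 \<le> ?\<mu> $ i" for i
      using explicit_constraints_iff[of W k "fst x" "fst (snd x)" "snd (snd x)"] by simp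
    have "0 < ?\<delta>" using eps k by simp
    define A where "A = {(gs, hist' :: ('n, 'g) history). \<forall>g\<in>set gs. score W ?\<mu> g < best_score W ?\<mu> - ?\<delta>}"
    define best where "best gs = arg_max (score W ?\<mu>) (\<lambda>g. g \<in> set gs)" for gs
    define f where "f = (\<lambda>(gs, hist' :: ('n, 'g) history). return_pmf
      (h @ [if score W ?\<mu> (best gs) > snd (snd x) then Hyperplane (workflow_constraint W (best gs)) else Weak_Certificate],
       bs @ [(?\<mu>, best gs)], hist'))"
    have "measure_pmf.prob (f y) ?B \<le> 1 * indicator A y + 0"
      if y: "y \<in> set_pmf (batch_calls orc ?\<mu> ?\<delta> m hist)" for y
    proof (cases "y \<in> A")
      case False
      obtain gs hist' where gs: "y = (gs, hist')" by (cases y)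
      \<comment> \<open>A batch is nonempty because \<open>m\<close> is at least 1, so
        \<open>arg_max\<close> has a candidate.\<close>
      then have "gs \<noteq> []" using length_batch_calls[of gs hist'] y m by fastforce
      then have "is_arg_max (score W ?\<mu>) (\<lambda>g. g \<in> set gs) (best gs)"
        unfolding best_def by (intro is_arg_max_arg_max_finite) auto
      then have "score W ?\<mu> (best gs) \<ge> best_score W ?\<mu> - ?\<delta>"
        using False unfolding gs A_def by (fastforce simp: is_arg_max_linorder)
      then have "batches_ok W ?\<delta> (bs @ [(?\<mu>, best gs)])" using bs by (auto simp: batches_ok_def)
      then show ?thesis by (simp add: f_def gs measure_return_pmf)
    qed simp
    then have "measure_pmf.prob (bind_pmf (batch_calls orc ?\<mu> ?\<delta> m hist) f) ?B
        \<le> 1 * measure_pmf.prob (batch_calls orc ?\<mu> ?\<delta> m hist) A + 0"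
      by (intro prob_bind_pmf_le) auto
    also have "\<dots> \<le> (1 - q) ^ m"
      using prob_batch_calls_fail[OF orc \<mu> \<open>0 < ?\<delta>\<close>, of m hist] by (simp add: A_def)
    also have "\<dots> \<le> exp (- q) ^ m"
    proof (intro power_mono)
      show "1 - q \<le> exp (- q)" using exp_ge_add_one_self[of "- q"] by simp
      have "q \<le> measure_pmf.prob (orc hist ?\<mu> ?\<delta>) {g. score W ?\<mu> g \<ge> best_score W ?\<mu> - ?\<delta>}"
        using orc \<mu> \<open>0 < ?\<delta>\<close> by (simp add: pricing_guarantee_def)
      also have "\<dots> \<le> 1" by simp
      finally show "0 \<le> 1 - q" by simp
    qed
    also have "\<dots> = exp (- q * real m)" by (simp add: mult.commute flip: exp_of_nat_mult)
    finally show ?thesis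
      using 3 unfolding step f_def best_def Let_def by simp
  qed (use return in \<open>simp_all add: step\<close>)
qed

text \<open>A union bound along a chain: from any state outside \<open>B\<close> one step enters it
  with probability at most \<open>e\<close>, and from inside \<open>B\<close> the trivial bound 1 is
  used.\<close>

lemma prob_repeat_step_fail:
  assumes "\<And>s. s \<notin> B \<Longrightarrow> measure_pmf.prob (f s) B \<le> e" "0 \<le> e" "s \<notin> B"
  shows "measure_pmf.prob (repeat_step j f s) B \<le> real j * e"
  using assms(3)
proof (induction j arbitrary: s)
  case (Suc j)
  have "measure_pmf.prob (repeat_step j f x) B \<le> 1 * indicator B x + real j * e" for x
  proof (cases "x \<in> B")
    case True
    have "measure_pmf.prob (repeat_step j f x) B \<le> 1" by simp
    also have "\<dots> \<le> 1 + real j * e" using assms(2) by simp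
    finally show ?thesis using True by simp
  qed (use Suc.IH in simp)
  then have "measure_pmf.prob (bind_pmf (f s) (repeat_step j f)) B \<le> 1 * measure_pmf.prob (f s) B + real j * e"
    using assms(2) by (intro prob_bind_pmf_le) auto
  also have "\<dots> \<le> e + real j * e" using assms(1)[OF Suc.prems] by simp
  finally show ?case by (simp add: algebra_simps)
qed (simp add: measure_return_pmf)

text \<open>The query history passes from size to size, hence the induction over arbitrary
  \<open>hist\<close>: the first run and the remaining runs given its outcome contribute one summand
  each.\<close>

lemma prob_pricing_runs_fail:
  fixes W :: "('n::finite, 'g::finite) workflow_problem"
  assumes orc: "pricing_guarantee W orc q" and eps: "0 < eps" and m: "1 \<le> m"
    and "distinct ks" "\<And>k. k \<in> set ks \<Longrightarrow> 1 \<le> k"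
  shows "measure_pmf.prob (pricing_runs W orc m eps prec stop N ks hist) {R. \<not> all_batches_ok W eps (set ks) R}
    \<le> real (\<Sum>k\<in>set ks. N k) * exp (- q * real m)"
  using assms(4,5)
proof (induction ks arbitrary: hist)
  case (Cons k ks)
  let ?\<delta> = "eps / (2 * real k)" and ?e = "exp (- q * real m)"
  let ?B = "{(h :: 'n dual answer list, bs, hist :: ('n, 'g) history). \<not> batches_ok W ?\<delta> bs}"
  let ?C = "\<lambda>ks. {R. \<not> all_batches_ok W eps (set ks) R}"
  let ?run = "repeat_step (N k) (ellipsoid_step W orc m eps (prec k) (stop k) k) ([], [], hist)"
  have k: "1 \<le> k" "k \<notin> set ks" using Cons.prems by auto
  have step: "measure_pmf.prob (ellipsoid_step W orc m eps (prec k) (stop k) k s) ?B \<le> ?e" if "s \<notin> ?B" for s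
    using that prob_ellipsoid_step_fail[OF orc eps k(1) m] by (cases s) auto
  have run: "measure_pmf.prob ?run ?B \<le> real (N k) * ?e"
    by (rule prob_repeat_step_fail[OF step]) (auto simp: batches_ok_def)
  define f where "f = (\<lambda>(h :: 'n dual answer list, bs, hist'). map_pmf (\<lambda>R. R(k := bs)) (pricing_runs W orc m eps prec stop N ks hist'))"
  let ?d = "real (\<Sum>k\<in>set ks. N k) * ?e"
  have d: "0 \<le> ?d" by (intro mult_nonneg_nonneg of_nat_0_le_iff exp_ge_zero)
  have "measure_pmf.prob (f s) (?C (k # ks)) \<le> 1 * indicator ?B s + ?d" for s
  proof (cases "s \<in> ?B")
    case True
    have "measure_pmf.prob (f s) (?C (k # ks)) \<le> 1" by simp
    also have "\<dots> \<le> 1 + ?d" using d by simp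
    finally show ?thesis using True by simp
  next
    case False
    obtain h bs hist' where s: "s = (h, bs, hist')" by (cases s)
    \<comment> \<open>As \<open>k\<close> does not occur in \<open>ks\<close>, the update leaves the
      other sizes untouched, and the entry for \<open>k\<close> is successful in this case.\<close>
    have "(\<lambda>R. R(k := bs)) -` ?C (k # ks) = ?C ks"
      using False k(2) by (auto simp: s all_batches_ok_iff)
    moreover have "measure_pmf.prob (pricing_runs W orc m eps prec stop N ks hist') (?C ks) \<le> ?d"
      using Cons by simp
    ultimately show ?thesis using False by (simp only: f_def s prod.case measure_map_pmf) simp
  qed
  then have "measure_pmf.prob (bind_pmf ?run f) (?C (k # ks)) \<le> 1 * measure_pmf.prob ?run ?B + ?d"
    using d by (intro prob_bind_pmf_le) auto
  also have "\<dots> \<le> real (N k) * ?e + ?d" using run by simp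
  finally show ?case using k(2) by (simp add: f_def map_pmf_def case_prod_unfold algebra_simps)
qed (simp add: all_batches_ok_def)

section \<open>Ellipsoid runs\<close>

text \<open>Ties every answer to its cause, a violated explicit constraint or a recorded batch at
  the prices of the iterate. It does not claim that pricing succeeded, and it asks only for
  membership in \<open>bs\<close>, so later batches preserve it.\<close>

definition run_inv ::
  "('n::finite, 'g::finite) workflow_problem \<Rightarrow> nat \<Rightarrow> ('n dual answer list \<Rightarrow> bool) \<Rightarrow> nat \<Rightarrow>
   'n dual answer list \<Rightarrow> ((real ^ 'n) \<times> 'g) list \<Rightarrow> bool" where
  "run_inv W p stop k h bs \<longleftrightarrow> (\<forall>t < length h. \<not> stop (take t h) \<and>
     ((\<exists>c \<in> explicit_constraints W k. \<not> satisfies (iterate W p k (take t h)) c \<and> h ! t = Hyperplane c) \<or>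
      (\<forall>c \<in> explicit_constraints W k. satisfies (iterate W p k (take t h)) c) \<and>
      (\<exists>g. (fst (iterate W p k (take t h)), g) \<in> set bs \<and>
         h ! t = (if score W (fst (iterate W p k (take t h))) g > snd (snd (iterate W p k (take t h)))
                  then Hyperplane (workflow_constraint W g) else Weak_Certificate))))"

lemma run_inv_append:
  assumes "run_inv W p stop k h bs" "\<not> stop h"
    and "(\<exists>c \<in> explicit_constraints W k. \<not> satisfies (iterate W p k h) c \<and> ans = Hyperplane c) \<or>
      (\<forall>c \<in> explicit_constraints W k. satisfies (iterate W p k h) c) \<and>
      (\<exists>g. (fst (iterate W p k h), g) \<in> set bs' \<and>
         ans = (if score W (fst (iterate W p k h)) g > snd (snd (iterate W p k h))
                then Hyperplane (workflow_constraint W g) else Weak_Certificate))"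
    and "set bs \<subseteq> set bs'"
  shows "run_inv W p stop k (h @ [ans]) bs'"
  unfolding run_inv_def
proof (intro allI impI)
  fix t assume t: "t < length (h @ [ans])"
  show "\<not> stop (take t (h @ [ans])) \<and>
     ((\<exists>c \<in> explicit_constraints W k. \<not> satisfies (iterate W p k (take t (h @ [ans]))) c \<and> (h @ [ans]) ! t = Hyperplane c) \<or>
      (\<forall>c \<in> explicit_constraints W k. satisfies (iterate W p k (take t (h @ [ans]))) c) \<and>
      (\<exists>g. (fst (iterate W p k (take t (h @ [ans]))), g) \<in> set bs' \<and>
         (h @ [ans]) ! t = (if score W (fst (iterate W p k (take t (h @ [ans])))) g > snd (snd (iterate W p k (take t (h @ [ans]))))
                  then Hyperplane (workflow_constraint W g) else Weak_Certificate)))"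
  proof (cases "t < length h")
    case True
    then have *: "take t (h @ [ans]) = take t h" "(h @ [ans]) ! t = h ! t" by (simp_all add: nth_append)
    show ?thesis unfolding * using assms(1,4) True unfolding run_inv_def by (meson subsetD)
  next
    case False
    with t have *: "take t (h @ [ans]) = h" "(h @ [ans]) ! t = ans" by (simp_all add: nth_append)
    show ?thesis unfolding * using assms(2,3) by blast
  qed
qed

lemma ellipsoid_step_inv:
  assumes inv: "run_inv W p stop k h bs"
    and st: "(h', bs', hist') \<in> set_pmf (ellipsoid_step W orc m eps p stop k (h, bs, hist))"
  shows "run_inv W p stop k h' bs' \<and> (if stop h then h' = h else length h' = Suc (length h))"
proof -
  define x where "x = iterate W p k h"
  define viol where "viol = {c \<in> explicit_constraints W k. \<not> satisfies x c}"
  consider "stop h" | "\<not> stop h" "viol \<noteq> {}" | "\<not> stop h" "viol = {}" by blast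
  then show ?thesis
  proof cases
    case 1
    then show ?thesis using inv st by (simp add: ellipsoid_step_def)
  next
    case 2
    then have eq: "h' = h @ [Hyperplane (SOME c. c \<in> viol)]" "bs' = bs"
      using st unfolding ellipsoid_step_def Let_def prod.case x_def[symmetric] viol_def[symmetric] by simp_all
    have "(SOME c. c \<in> viol) \<in> viol" using 2 by (simp add: some_in_eq)
    then show ?thesis
      using 2 unfolding eq by (auto intro!: run_inv_append[OF inv] simp: viol_def x_def)
  next
    case 3
    then obtain g where eq: "bs' = bs @ [(fst x, g)]"
      "h' = h @ [if score W (fst x) g > snd (snd x) then Hyperplane (workflow_constraint W g) else Weak_Certificate]"
      using st unfolding ellipsoid_step_def Let_def prod.case x_def[symmetric] viol_def[symmetric]
      by auto
    have "run_inv W p stop k h' bs'"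
      unfolding eq using 3 by (intro run_inv_append[OF inv]) (auto simp: viol_def x_def)
    then show ?thesis using 3 by (simp add: eq)
  qed
qed

text \<open>Until it stops, a run receives one answer per step, so the number of answers counts the
  steps.\<close>

lemma repeat_step_inv:
  assumes "(h', bs', hist') \<in> set_pmf (repeat_step j (ellipsoid_step W orc m eps p stop k) (h, bs, hist))"
    and "run_inv W p stop k h bs" "stop h \<or> length h = n"
  shows "run_inv W p stop k h' bs' \<and> (stop h' \<or> length h' = n + j)"
  using assms
proof (induction j arbitrary: h bs hist n)
  case (Suc j)
  then obtain h1 bs1 hist1 where
    1: "(h1, bs1, hist1) \<in> set_pmf (ellipsoid_step W orc m eps p stop k (h, bs, hist))" and
    2: "(h', bs', hist') \<in> set_pmf (repeat_step j (ellipsoid_step W orc m eps p stop k) (h1, bs1, hist1))"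
    by auto
  have "run_inv W p stop k h1 bs1" "stop h1 \<or> length h1 = Suc n"
    using ellipsoid_step_inv[OF Suc.prems(2) 1] Suc.prems(3) by (auto split: if_splits)
  from Suc.IH[OF 2 this] show ?case by simp
qed simp

text \<open>An unstopped run would have exactly \<open>N\<close> answers, and the bound yields a
  stopping prefix: the whole list is excluded by assumption, a proper prefix by
  \<open>run_inv\<close>.\<close>

lemma repeat_step_stops:
  assumes bound: "iteration_bound stop N"
    and st: "(h, bs, hist') \<in> set_pmf (repeat_step N (ellipsoid_step W orc m eps p stop k) ([], [], hist))"
  shows "run_inv W p stop k h bs" "stop h"
proof -
  have *: "run_inv W p stop k h bs \<and> (stop h \<or> length h = 0 + N)"
    using st by (rule repeat_step_inv) (auto simp: run_inv_def)
  then show inv: "run_inv W p stop k h bs" by simp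
  show "stop h"
  proof (rule ccontr)
    assume "\<not> stop h"
    then have "length h = N" using * by simp
    then obtain t where t: "t \<le> length h" "stop (take t h)" using bound by (auto simp: iteration_bound_def)
    with \<open>\<not> stop h\<close> have "t < length h" by (cases "t = length h") auto
    then show False using inv t(2) by (simp add: run_inv_def)
  qed
qed

text \<open>Hyperplanes come from explicit constraints or recorded workflows, so they are
  constraints of every class containing the latter. A certificate bounds the scores of all workflows
  because the retained one is within \<delta> of the best.\<close>

lemma run_inv_valid_run:
  assumes inv: "run_inv W p stop k h bs" and ok: "batches_ok W \<delta> bs" and M: "snd ` set bs \<subseteq> M"
  shows "valid_run W p stop k \<delta> M h"
  unfolding valid_run_def
proof (intro allI impI conjI)
  fix t assume t: "t < length h"
  define x where "x = iterate W p k (take t h)"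
  show "\<not> stop (take t h)" using inv t by (simp add: run_inv_def)
  have "(\<exists>c \<in> explicit_constraints W k. \<not> satisfies x c \<and> h ! t = Hyperplane c) \<or>
      (\<forall>c \<in> explicit_constraints W k. satisfies x c) \<and>
      (\<exists>g. (fst x, g) \<in> set bs \<and>
         h ! t = (if score W (fst x) g > snd (snd x) then Hyperplane (workflow_constraint W g) else Weak_Certificate))"
    using inv t unfolding run_inv_def x_def by blast
  then show "valid_answer W k \<delta> M (iterate W p k (take t h)) (h ! t)"
    unfolding x_def[symmetric]
  proof (elim disjE conjE bexE exE)
    fix c assume "c \<in> explicit_constraints W k" "\<not> satisfies x c" "h ! t = Hyperplane c"
    then show "valid_answer W k \<delta> M x (h ! t)" by (simp add: valid_answer_def)
  next
    fix g assume sat: "\<forall>c \<in> explicit_constraints W k. satisfies x c" and g: "(fst x, g) \<in> set bs"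
      and ht: "h ! t = (if score W (fst x) g > snd (snd x) then Hyperplane (workflow_constraint W g) else Weak_Certificate)"
    show "valid_answer W k \<delta> M x (h ! t)"
    proof (cases "score W (fst x) g > snd (snd x)")
      case True
      have "\<not> satisfies x (workflow_constraint W g)"
        using True satisfies_workflow_constraint[of "fst x" "fst (snd x)" "snd (snd x)" W g] by simp
      then show ?thesis using True g M by (force simp: ht valid_answer_def)
    next
      case False
      have best: "best_score W (fst x) \<le> score W (fst x) g + \<delta>"
        using ok g by (fastforce simp: batches_ok_def)
      have "score W (fst x) g' \<le> snd (snd x) + \<delta>" for g'
      proof -
        have "score W (fst x) g' \<le> best_score W (fst x)" unfolding best_score_def by simp
        with best False show ?thesis by linarith
      qed
      then show ?thesis using False sat by (simp add: ht valid_answer_def)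
    qed
  qed
qed

text \<open>The routine sees only the answers, which are as valid for the recorded subclass as for all
  workflows. So one certified point is nearly optimal for the restricted dual and at the same time
  nearly feasible for the full one.\<close>

lemma run_recovers:
  fixes W :: "('n::finite, 'g::finite) workflow_problem"
  assumes W: "valid_problem W" and k: "1 \<le> k"
    and tol: "ellipsoid_tolerance W p stop k eps"
    and inv: "run_inv W p stop k h bs" and stop: "stop h"
    and ok: "batches_ok W (eps / (2 * real k)) bs"
  defines "M \<equiv> snd ` set bs"
  shows "M \<noteq> {}" "z \<in> lp_feasible k UNIV \<Longrightarrow> lp_objective W k z - eps \<le> lp_objective W k (recovered W k M)"
proof -
  have valid: "valid_run W p stop k (eps / (2 * real k)) M' h" if "M \<subseteq> M'" for M'
    using run_inv_valid_run[OF inv ok] that by (simp add: M_def)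
  \<comment> \<open>The tolerance property asks for a nonempty class. Applied to all workflows it
    yields a certificate, hence a batch, hence a nonempty \<open>M\<close>.\<close>
  have "tolerance_reached W p k (eps / 2) UNIV h"
    using tol valid[of UNIV] stop by (auto simp: ellipsoid_tolerance_def)
  then obtain t where t: "t < length h" "h ! t = Weak_Certificate" by (auto simp: tolerance_reached_def)
  with inv have "bs \<noteq> []" by (fastforce simp: run_inv_def)
  then show M: "M \<noteq> {}" by (simp add: M_def)
  then have "tolerance_reached W p k (eps / 2) M h"
    using tol valid[of M] stop by (auto simp: ellipsoid_tolerance_def)
  then obtain t where t: "t < length h" "h ! t = Weak_Certificate" and
    opt: "\<And>y. y \<in> dual_feasible W k M \<Longrightarrow> dual_objective k (iterate W p k (take t h)) \<le> dual_objective k y + eps / 2"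
    by (auto simp: tolerance_reached_def)
  have "valid_answer W k (eps / (2 * real k)) UNIV (iterate W p k (take t h)) Weak_Certificate"
    using valid[of UNIV] t by (auto simp: valid_run_def)
  then show "lp_objective W k z - eps \<le> lp_objective W k (recovered W k M)" if "z \<in> lp_feasible k UNIV"
    using that opt by (intro recovered_near_optimal[OF W k M]) (auto simp: valid_answer_def)
qed

text \<open>Each run starts without answers and batches, but with the history left by earlier sizes;
  hence the existential \<open>hist0\<close>.\<close>

lemma pricing_runs_support:
  assumes "R \<in> set_pmf (pricing_runs W orc m eps prec stop N ks hist)" "distinct ks" "k \<in> set ks"
  shows "\<exists>h hist0 hist'.
    (h, R k, hist') \<in> set_pmf (repeat_step (N k) (ellipsoid_step W orc m eps (prec k) (stop k) k) ([], [], hist0))"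
  using assms
proof (induction ks arbitrary: R hist)
  case (Cons k' ks)
  obtain h bs hist' R' where
    1: "(h, bs, hist') \<in> set_pmf (repeat_step (N k') (ellipsoid_step W orc m eps (prec k') (stop k') k') ([], [], hist))" and
    2: "R' \<in> set_pmf (pricing_runs W orc m eps prec stop N ks hist')" and R: "R = R'(k' := bs)"
    using Cons.prems(1) by auto
  show ?case
  proof (cases "k = k'")
    case True
    then show ?thesis using 1 by (auto simp: R)
  next
    case False
    then show ?thesis using Cons.IH[OF 2] Cons.prems(2,3) by (simp add: R)
  qed
qed simp

section \<open>The returned portfolio\<close>

lemma finite_bounded_psize: "finite {m :: 'g::finite \<Rightarrow> nat. psize m \<le> Kmax}"
proof (rule finite_subset)
  show "{m :: 'g \<Rightarrow> nat. psize m \<le> Kmax} \<subseteq> UNIV \<rightarrow>\<^sub>E {..Kmax}"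
  proof
    fix m :: "'g \<Rightarrow> nat" assume "m \<in> {m. psize m \<le> Kmax}"
    then have "m g \<le> Kmax" for g using member_le_sum[of g UNIV m] by (simp add: psize_def)
    then show "m \<in> UNIV \<rightarrow>\<^sub>E {..Kmax}" by auto
  qed
  show "finite (UNIV \<rightarrow>\<^sub>E {..Kmax} :: ('g \<Rightarrow> nat) set)" by (intro finite_PiE) auto
qed

lemma OPT_attained:
  obtains m where "psize m \<le> Kmax" "profit W m = OPT W Kmax"
proof -
  have "psize (\<lambda>_. 0) \<le> Kmax" by (simp add: psize_def)
  then have "OPT W Kmax \<in> profit W ` {m. psize m \<le> Kmax}"
    unfolding OPT_def by (intro Max_in finite_imageI finite_bounded_psize) auto
  then show ?thesis using that by auto
qed

lemma profit_le_OPT: "psize m \<le> Kmax \<Longrightarrow> profit W m \<le> OPT W Kmax"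
  unfolding OPT_def by (intro Max_ge finite_imageI finite_bounded_psize) auto

text \<open>In every outcome the selected portfolio is at least as good as each candidate, and
  component \<open>k\<close> of the product law is the rounding law of that size.\<close>

lemma E_rnd_ge:
  fixes W :: "('n::finite, 'g::finite) workflow_problem"
  assumes K: "finite K"
  shows "profit W m0 \<le> E_rnd W K m0 R"
    and "k \<in> K \<Longrightarrow>
      measure_pmf.expectation (rounded k (recovered W k (snd ` set (R k)))) (profit W) \<le> E_rnd W K m0 R"
proof -
  let ?P = "Pi_pmf K (\<lambda>_. 0) (\<lambda>k. rounded k (recovered W k (snd ` set (R k))))"
  have "finite (set_pmf ?P)"
    by (rule finite_subset[OF set_Pi_pmf_subset'[OF K]]) (use K finite_set_rounded in \<open>auto intro!: finite_PiE_dflt\<close>)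
  then have int: "integrable ?P f" for f :: "(nat \<Rightarrow> 'g \<Rightarrow> nat) \<Rightarrow> real"
    by (rule integrable_measure_pmf_finite)
  have E: "E_rnd W K m0 R = measure_pmf.expectation ?P (\<lambda>MR. profit W (select_best W K m0 MR))"
    by (simp add: E_rnd_def returned_def)
  have sel: "profit W m \<le> profit W (select_best W K m0 MR)" if "m \<in> {(\<lambda>_. 0), m0} \<union> MR ` K" for m MR
    using is_arg_max_arg_max_finite[of "{(\<lambda>_. 0), m0} \<union> MR ` K" "profit W"] K that
    unfolding select_best_def is_arg_max_linorder by blast
  show "profit W m0 \<le> E_rnd W K m0 R"
    unfolding E by (intro measure_pmf.integral_ge_const int) (auto intro: sel)
  assume k: "k \<in> K"
  have "measure_pmf.expectation (rounded k (recovered W k (snd ` set (R k)))) (profit W)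
      = measure_pmf.expectation (map_pmf (\<lambda>f. f k) ?P) (profit W)"
    using k by (simp add: Pi_pmf_component[OF K] del: integral_map_pmf)
  also have "\<dots> = measure_pmf.expectation ?P (\<lambda>MR. profit W (MR k))" by simp
  also have "\<dots> \<le> E_rnd W K m0 R" unfolding E using k by (intro integral_mono int sel) auto
  finally show "measure_pmf.expectation (rounded k (recovered W k (snd ` set (R k)))) (profit W) \<le> E_rnd W K m0 R" .
qed

lemma c_PL_le_eps_rnd:
  assumes "finite K" "k \<in> K"
  shows "c_PL k lam / exp 1 \<le> eps_rnd K lam"
  using assms Max_ge[of "(\<lambda>k. c_PL k lam) ` K" "c_PL k lam"]
  by (simp add: eps_rnd_def divide_right_mono)

text \<open>The multiplicative bound is the convex combination of the two additive ones with weights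
  \<open>e / (V + e)\<close> and \<open>V / (V + e)\<close>.\<close>

lemma multiplicative_from_additive:
  fixes V e x y :: real
  assumes "0 < V" "0 \<le> e" "V \<le> y" "x - e \<le> y"
  shows "V / (V + e) * x \<le> y"
proof -
  have "V * x = e * V + V * (x - e)" by algebra
  also have "\<dots> \<le> e * y + V * y" using assms by (intro add_mono mult_left_mono) auto
  finally show ?thesis using assms by (simp add: divide_simps algebra_simps)
qed

theorem theorem4:
  fixes W :: "('n::finite, 'g::finite) workflow_problem"
    and B Kmax m Nell T :: nat
    and K :: "nat set"
    and \<rho> V p_orc eps :: real
    and m0 :: "'g \<Rightarrow> nat"
    and orc :: "('n, 'g) oracle_law"
    and prec N :: "nat \<Rightarrow> nat"
    and stop :: "nat \<Rightarrow> 'n dual answer list \<Rightarrow> bool"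
  assumes "valid_problem W" and "encoding_bound W B" and "1 \<le> Kmax"
    and "K \<subseteq> {1..Kmax}" and "1 \<le> \<rho>" and "coverage Kmax K \<rho>"
    and "psize m0 \<le> Kmax" and "profit W m0 \<ge> V" and "V > 0"
    and "p_orc > 0" and "pricing_guarantee W orc p_orc"
    and "1 \<le> m" and "eps > 0"
    and "\<forall>k\<in>K. ellipsoid_tolerance W (prec k) (stop k) k eps"
    and "\<forall>k\<in>K. iteration_bound (stop k) (N k)"
    and "Nell = (\<Sum>k\<in>K. N k)" and "T = m * Nell"
  shows
    "measure_pmf.prob (pricing_phase W orc m eps prec stop N K)
       {R. all_batches_ok W eps K R
         \<and> E_rnd W K m0 R \<ge> max V (OPT W Kmax / \<rho> - eps - eps_rnd K (strength W))
         \<and> E_rnd W K m0 R \<ge> (1 / \<rho>) * (V / (V + eps + eps_rnd K (strength W))) * OPT W Kmax}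
       \<ge> 1 - real Nell * exp (- p_orc * real m)
     \<and> 1 - real Nell * exp (- p_orc * real m) = 1 - exp (- (p_orc * real T / real Nell) + ln (real Nell))
     \<and> (\<forall>R \<in> set_pmf (pricing_phase W orc m eps prec stop N K). all_batches_ok W eps K R \<longrightarrow>
          E_rnd W K m0 R \<ge> max V (OPT W Kmax / \<rho> - eps - eps_rnd K (strength W))
          \<and> E_rnd W K m0 R \<ge> (1 / \<rho>) * (V / (V + eps + eps_rnd K (strength W))) * OPT W Kmax)"
    (is "?prob \<ge> _ \<and> ?id \<and> (\<forall>R\<in>?S. _ \<longrightarrow> ?good R)")
proof -
  let ?D = "pricing_phase W orc m eps prec stop N K" and ?e = "eps_rnd K (strength W)"
  note W = assms(1) and \<rho> = \<open>1 \<le> \<rho>\<close> and V = \<open>V > 0\<close>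
  have lam: "1 \<le> strength W" using W by (simp add: valid_problem_def)
  have K: "finite K" "\<And>k. k \<in> K \<Longrightarrow> 1 \<le> k"
    using \<open>K \<subseteq> {1..Kmax}\<close> by (auto intro: finite_subset)
  obtain k1 where k1: "k1 \<in> K" using \<open>coverage Kmax K \<rho>\<close> \<open>1 \<le> Kmax\<close> by (force simp: coverage_def)
  have "0 \<le> c_PL k1 (strength W) / exp 1" using c_PL_ge(2)[OF lam K(2)[OF k1]] by simp
  then have e: "0 \<le> ?e" using c_PL_le_eps_rnd[OF K(1) k1, of "strength W"] by linarith

  \<comment> \<open>With bound 0 the routine would stop before its first query, but reaching the
    tolerance requires a certified iterate. So \<open>Nell\<close> is positive and its logarithm is
    meaningful.\<close>
  have "N k1 \<noteq> 0"
  proof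
    assume "N k1 = 0"
    then have "stop k1 []" using assms(15) k1 by (force simp: iteration_bound_def)
    then have "tolerance_reached W (prec k1) k1 (eps / 2) (UNIV :: 'g set) []"
      using assms(14) k1 by (auto simp: ellipsoid_tolerance_def valid_run_def)
    then show False by (simp add: tolerance_reached_def)
  qed
  then have Nell: "0 < Nell" using member_le_sum[of k1 K N] k1 K(1) assms(16) by simp
  then have id: ?id
    using \<open>T = m * Nell\<close> by (simp add: exp_diff exp_minus divide_inverse mult.commute)

  have good: "?good R" if R: "R \<in> set_pmf ?D" and ok: "all_batches_ok W eps K R" for R
  proof -
    have 1: "V \<le> E_rnd W K m0 R" using E_rnd_ge(1)[OF K(1), of W m0 R] \<open>profit W m0 \<ge> V\<close> by linarith
    obtain mopt where mopt: "psize mopt \<le> Kmax" "profit W mopt = OPT W Kmax" by (rule OPT_attained)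
    have OPT: "0 < OPT W Kmax" using profit_le_OPT[OF \<open>psize m0 \<le> Kmax\<close>, of W] \<open>profit W m0 \<ge> V\<close> V by linarith
    \<comment> \<open>Coverage speaks of sizes from 1 on; the empty portfolio has profit 0, whereas
      the baseline makes the optimum positive.\<close>
    have "psize mopt \<noteq> 0"
    proof
      assume "psize mopt = 0"
      then have "mopt = (\<lambda>_. 0)" by (auto simp: psize_def)
      then show False using OPT mopt(2) by (simp add: profit_def)
    qed
    then have "psize mopt \<in> {1..Kmax}" using mopt(1) by simp
    then have "psize mopt \<in> {1..Kmax}" using mopt(1) by simp
    then have "psize mopt \<in> {1..Kmax}" using mopt(1) by simp
    then have "psize mopt \<in> {1..Kmax}" using mopt(1) by simp
    then have "psize mopt \<in> {1..Kmax}" using mopt(1) by simp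
    then obtain b where b: "b \<in> K" "b \<le> psize mopt" "real (psize mopt) \<le> \<rho> * real b"
      using \<open>coverage Kmax K \<rho>\<close> unfolding coverage_def by blast
    have b1: "1 \<le> b" by (rule K(2)[OF b(1)])
    obtain z where z: "z \<in> lp_feasible b UNIV" "real b / real (psize mopt) * profit W mopt \<le> lp_objective W b z"
      by (rule profit_scaled_le_lp[OF W b1 b(2)])
    have "1 / \<rho> \<le> real b / real (psize mopt)"
      using b b1 \<rho> \<open>psize mopt \<noteq> 0\<close> by (simp add: divide_simps mult.commute)
    then have "OPT W Kmax / \<rho> \<le> real b / real (psize mopt) * profit W mopt"
      using mult_right_mono[of "1 / \<rho>" "real b / real (psize mopt)" "OPT W Kmax"] OPT by (simp add: mopt(2))
    also note z(2)
    finally have lp: "OPT W Kmax / \<rho> \<le> lp_objective W b z" .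
    have "R \<in> set_pmf (pricing_runs W orc m eps prec stop N (sorted_list_of_set K) [])"
      using R by (simp add: pricing_phase_def)
    then obtain h hist0 hist' where run:
      "(h, R b, hist') \<in> set_pmf (repeat_step (N b) (ellipsoid_step W orc m eps (prec b) (stop b) b) ([], [], hist0))"
      using pricing_runs_support[of R W orc m eps prec stop N _ _ b] K(1) b(1) by fastforce
    have bound: "iteration_bound (stop b) (N b)" using assms(15) b(1) by blast
    note inv = repeat_step_stops[OF bound run]
    let ?M = "snd ` set (R b)"
    have tol: "ellipsoid_tolerance W (prec b) (stop b) b eps" using assms(14) b(1) by blast
    have okb: "batches_ok W (eps / (2 * real b)) (R b)" using ok b(1) by (simp add: all_batches_ok_iff)
    have rec: "?M \<noteq> {}" "lp_objective W b z - eps \<le> lp_objective W b (recovered W b ?M)"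
      using run_recovers[OF W b1 tol inv okb] z(1) by blast+
    have "lp_objective W b (recovered W b ?M) - c_PL b (strength W) / exp 1
        \<le> measure_pmf.expectation (rounded b (recovered W b ?M)) (profit W)"
      by (rule expected_profit_rounded[OF W b1 recovered_optimal(1)[OF rec(1)]])
    also have "\<dots> \<le> E_rnd W K m0 R" by (rule E_rnd_ge(2)[OF K(1) b(1)])
    finally have 2: "OPT W Kmax / \<rho> - eps - ?e \<le> E_rnd W K m0 R"
      using lp rec(2) c_PL_le_eps_rnd[OF K(1) b(1), of "strength W"] by linarith
    have "V / (V + (eps + ?e)) * (OPT W Kmax / \<rho>) \<le> E_rnd W K m0 R"
      using V e \<open>eps > 0\<close> 1 2 by (intro multiplicative_from_additive) auto
    then show ?thesis using 1 2 by (simp add: mult.commute add.assoc)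
  qed

  let ?ok = "{R. all_batches_ok W eps K R}"
  have "measure_pmf.prob ?D {R. \<not> all_batches_ok W eps K R} \<le> real Nell * exp (- p_orc * real m)"
    using prob_pricing_runs_fail[OF \<open>pricing_guarantee W orc p_orc\<close> \<open>eps > 0\<close> \<open>1 \<le> m\<close>,
        of "sorted_list_of_set K" prec stop N "[]"] K assms(16)
    by (simp add: pricing_phase_def)
  moreover have "{R. \<not> all_batches_ok W eps K R} = UNIV - ?ok" by auto
  ultimately have "1 - real Nell * exp (- p_orc * real m) \<le> measure_pmf.prob ?D ?ok"
    using measure_pmf.prob_compl[of ?ok ?D] by simp
  \<comment> \<open>\<open>good\<close> concerns outcomes that a run can produce, so the event is
    first cut down to the support.\<close>
  also have "\<dots> = measure_pmf.prob ?D (?ok \<inter> set_pmf ?D)" by (simp add: measure_Int_set_pmf)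
  also have "\<dots> \<le> ?prob" using good by (intro measure_pmf.finite_measure_mono) auto
  finally show ?thesis using id good by blast
qed

end
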